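(* Let $X(t)=(X_1(t),\ldots,X_n(t))$ where $X_1,\ldots,X_n$ are (possibly degenerate) Lévy processes on $\mathbb{R}$ with $X(0)=0$, let $V=(V_1,\ldots,V_n):\mathbb{R}^n\to\mathbb{R}^n$ be locally Lipschitz, and for $x\in\mathbb{R}^n$ let $Y^x(t)$ be the solution of $$dY_i(t)=dX_i(t)+V_i(Y(t))\,dt,\quad i=1,\ldots,n,\qquad Y(0)=x.$$ Let $f:\mathbb{R}^n\to\mathbb{R}$ be a function in $C_b^2(\mathbb{R}^n)$ and fix $0<t_0<\infty$. Assume that the explosion time satisfies $\zeta(x,\omega)=\infty$ for all $x\in\mathbb{R}^n$ and all $\omega\in\Omega$, and let $T_tf(x)=\mathbb{E}[f(Y^x(t));\,t<\zeta(x)]=\mathbb{E}[f(Y^x(t))]$. Assume that $K\subset\mathbb{R}^n$ is such that $\operatorname{supp}(T_tf)\subset K$ for every $t\le t_0$, and that there exists a convex set $M\subset\mathbb{R}^n$ such that $Y^x(t,\omega)\in M$ for all $x\in K_3:=\bigcup_{x\in K}B^*(x,3)$, all $t\le t_0$ and all $\omega\in\Omega$. Assume that $\|V\|_{\infty,M}<\infty$ and $\|D^{(j)}V\|_{\infty,M}<\infty$ for $j=1,2,3$. Then $$T_tf\in C_b^2(\mathbb{R}^n)\quad\text{for all } t\le t_0.$$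
   Context: The probability space $\Omega$ is such that the equation holds for every $\omega$: $X(0)=0$ and $Y^x(t)=x+X(t)+\int_0^tV(Y^x(s))\,ds$ for all $t\ge0$ and all $\omega\in\Omega$. The explosion time $\zeta(x,\omega)\in[0,\infty]$ is the stopping time up to which the unique solution started at $x$ exists, with $\limsup_{t\to\zeta}|Y^x(t)|=\infty$ a.s. on $\{\zeta<\infty\}$. Some or all of the $X_i$ may be identically $0$. $C_b^2(\mathbb{R}^n)$: functions in $C^2$ which are bounded together with all their derivatives up to order $2$. $\|x\|=\max_i|x_i|$ and $B^*(x,r)=\{y\in\mathbb{R}^n:\|y-x\|<r\}$. For $A\subset\mathbb{R}^n$, $\|V\|_{\infty,A}=\sum_{i=1}^n\sup_{x\in A}|V_i(x)|$ and $\|D^{(j)}V\|_{\infty,A}=\sum_{i=1}^n\sum_{|\alpha|=j}\sup_{x\in A}|D^\alpha V_i(x)|$, the inner sum being over multi-indices $\alpha\in\mathbb{N}_0^n$. *)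

theory Defs
  imports "HOL-Probability.Probability"
begin

definition cadlag :: "(real \<Rightarrow> 'a::topological_space) \<Rightarrow> bool" where
  "cadlag p \<longleftrightarrow>
     (\<forall>t\<ge>0. (p \<longlongrightarrow> p t) (at_right t)) \<and> (\<forall>t>0. \<exists>l. (p \<longlongrightarrow> l) (at_left t))"

text \<open>Sato's definition: the cadlag property is required almost surely only, and the
  process may be degenerate (identically zero).\<close>

definition levy_process :: "'w measure \<Rightarrow> (real \<Rightarrow> 'w \<Rightarrow> real) \<Rightarrow> bool" where
  "levy_process P X \<longleftrightarrow>
     prob_space P \<and>
     (\<forall>t\<ge>0. X t \<in> borel_measurable P) \<and>
     (AE \<omega> in P. X 0 \<omega> = 0) \<and>
     (\<forall>(m::nat) (\<tau>::nat \<Rightarrow> real). 0 \<le> \<tau> 0 \<and> (\<forall>k<m. \<tau> k \<le> \<tau> (Suc k)) \<longrightarrow>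
        prob_space.indep_vars P (\<lambda>_. borel) (\<lambda>k \<omega>. X (\<tau> (Suc k)) \<omega> - X (\<tau> k) \<omega>) {..<m}) \<and>
     (\<forall>s\<ge>0. \<forall>h\<ge>0.
        distr P borel (\<lambda>\<omega>. X (s + h) \<omega> - X s \<omega>) = distr P borel (X h)) \<and>
     (\<forall>t\<ge>0. \<forall>\<epsilon>>0.
        ((\<lambda>s. measure P {\<omega> \<in> space P. \<bar>X s \<omega> - X t \<omega>\<bar> > \<epsilon>}) \<longlongrightarrow> 0) (at t within {0..})) \<and>
     (AE \<omega> in P. cadlag (\<lambda>t. X t \<omega>))"


text \<open>The equation is a pathwise one: \<open>\<xi>\<close> is a fixed path of the driving process, \<open>y\<close> a path of
  the solution, considered on the time interval \<open>[0, T)\<close>.\<close>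

definition solves_until ::
  "(real^'n \<Rightarrow> real^'n) \<Rightarrow> (real \<Rightarrow> real^'n) \<Rightarrow> real^'n \<Rightarrow> (real \<Rightarrow> real^'n) \<Rightarrow> ereal \<Rightarrow> bool" where
  "solves_until V \<xi> x y T \<longleftrightarrow>
     (\<forall>t\<ge>0. ereal t < T \<longrightarrow>
        (\<lambda>s. V (y s)) integrable_on {0..t} \<and>
        y t = x + \<xi> t + integral {0..t} (\<lambda>s. V (y s)))"

definition explosion_time ::
  "(real^'n \<Rightarrow> real^'n) \<Rightarrow> (real \<Rightarrow> real^'n) \<Rightarrow> real^'n \<Rightarrow> ereal" where
  "explosion_time V \<xi> x = Sup {T. \<exists>y. solves_until V \<xi> x y T}"

text \<open>The values of a solution process after the explosion time are irrelevant.\<close>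

definition solution_process ::
  "'w measure \<Rightarrow> (real^'n \<Rightarrow> real^'n) \<Rightarrow> (real \<Rightarrow> 'w \<Rightarrow> real^'n) \<Rightarrow> real^'n
    \<Rightarrow> (real \<Rightarrow> 'w \<Rightarrow> real^'n) \<Rightarrow> bool" where
  "solution_process P V X x Y \<longleftrightarrow>
     (\<forall>t\<ge>0. Y t \<in> borel_measurable P) \<and>
     (\<forall>\<omega>\<in>space P.
        solves_until V (\<lambda>t. X t \<omega>) x (\<lambda>t. Y t \<omega>) (explosion_time V (\<lambda>t. X t \<omega>) x))"

definition transition_op ::
  "'w measure \<Rightarrow> (real^'n \<Rightarrow> real^'n) \<Rightarrow> (real \<Rightarrow> 'w \<Rightarrow> real^'n)
    \<Rightarrow> (real^'n \<Rightarrow> real \<Rightarrow> 'w \<Rightarrow> real^'n) \<Rightarrow> real \<Rightarrow> (real^'n \<Rightarrow> real) \<Rightarrow> real^'n \<Rightarrow> real" where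
  "transition_op P V X Y t f x =
     (LINT \<omega>:{\<omega> \<in> space P. ereal t < explosion_time V (\<lambda>s. X s \<omega>) x}|P. f (Y x t \<omega>))"


text \<open>Iterated partial derivatives along a list of coordinate directions (the head of the list is
  differentiated last). \<open>has_partials\<close> says that the iterated derivative exists at a point; the
  derivative of lower order then has to exist near that point on the relevant coordinate line.\<close>

primrec partials :: "'n list \<Rightarrow> (real^'n \<Rightarrow> real) \<Rightarrow> real^'n \<Rightarrow> real" where
  "partials [] g = g"
| "partials (i # is) g = (\<lambda>x. deriv (\<lambda>s. partials is g (x + s *\<^sub>R axis i 1)) 0)"

primrec has_partials :: "'n list \<Rightarrow> (real^'n \<Rightarrow> real) \<Rightarrow> real^'n \<Rightarrow> bool" where
  "has_partials [] g = (\<lambda>x. True)"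
| "has_partials (i # is) g =
     (\<lambda>x. (\<forall>\<^sub>F s in nhds 0. has_partials is g (x + s *\<^sub>R axis i 1)) \<and>
          (\<lambda>s. partials is g (x + s *\<^sub>R axis i 1)) differentiable (at 0))"

text \<open>Multi-indices are functions \<open>'n \<Rightarrow> nat\<close>. As the notation $D^\alpha$ does not mention an order
  of differentiation, \<open>has_multi_deriv\<close> demands that every order gives the same value.\<close>

definition has_multi_deriv ::
  "('n::finite \<Rightarrow> nat) \<Rightarrow> (real^'n \<Rightarrow> real) \<Rightarrow> real \<Rightarrow> real^'n \<Rightarrow> bool" where
  "has_multi_deriv \<alpha> g d x \<longleftrightarrow>
     (\<forall>is. (\<forall>i. count_list is i = \<alpha> i) \<longrightarrow> has_partials is g x \<and> partials is g x = d)"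

definition multi_deriv :: "('n::finite \<Rightarrow> nat) \<Rightarrow> (real^'n \<Rightarrow> real) \<Rightarrow> real^'n \<Rightarrow> real" where
  "multi_deriv \<alpha> g x = (THE d. has_multi_deriv \<alpha> g d x)"

lemma has_multi_deriv_imp_multi_deriv:
  assumes "has_multi_deriv \<alpha> g d x"
  shows "multi_deriv \<alpha> g x = d"
proof -
  obtain A where A: "\<And>i. count A i = \<alpha> i"
    using count_Abs_multiset[of \<alpha>] by (metis finite)
  obtain "is" where "mset is = A"
    using ex_mset by blast
  hence "\<forall>i. count_list is i = \<alpha> i"
    using A by (metis count_mset)
  thus ?thesis
    using assms unfolding multi_deriv_def has_multi_deriv_def by blast
qed

definition C_b :: "nat \<Rightarrow> (real^'n::finite \<Rightarrow> real) set" where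
  "C_b k = {g. \<forall>\<alpha>. sum \<alpha> UNIV \<le> k \<longrightarrow>
     (\<forall>x. \<exists>d. has_multi_deriv \<alpha> g d x) \<and>
     continuous_on UNIV (multi_deriv \<alpha> g) \<and>
     bounded (range (multi_deriv \<alpha> g))}"


text \<open>The norms may be infinite, hence take values in \<^typ>\<open>ennreal\<close>; \<open>deriv_norm j A V\<close> is only
  meaningful where the derivatives of order \<open>j\<close> exist on \<open>A\<close>.\<close>

definition sup_norm :: "(real^'n) set \<Rightarrow> (real^'n \<Rightarrow> real^'n) \<Rightarrow> ennreal" where
  "sup_norm A V = (\<Sum>i\<in>UNIV. SUP x\<in>A. ennreal \<bar>V x $ i\<bar>)"

definition derivs_exist_on :: "nat \<Rightarrow> (real^'n) set \<Rightarrow> (real^'n::finite \<Rightarrow> real^'n) \<Rightarrow> bool" where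
  "derivs_exist_on j A V \<longleftrightarrow>
     (\<forall>i. \<forall>\<alpha>. sum \<alpha> UNIV = j \<longrightarrow> (\<forall>x\<in>A. \<exists>d. has_multi_deriv \<alpha> (\<lambda>y. V y $ i) d x))"

definition deriv_norm :: "nat \<Rightarrow> (real^'n) set \<Rightarrow> (real^'n::finite \<Rightarrow> real^'n) \<Rightarrow> ennreal" where
  "deriv_norm j A V =
     (\<Sum>i\<in>UNIV. \<Sum>\<alpha> | sum \<alpha> UNIV = j. SUP x\<in>A. ennreal \<bar>multi_deriv \<alpha> (\<lambda>y. V y $ i) x\<bar>)"

text \<open>\<^const>\<open>infnorm\<close> is the maximum norm on \<^typ>\<open>real^'n\<close>.\<close>

definition cube :: "real^'n \<Rightarrow> real \<Rightarrow> (real^'n) set" where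
  "cube x r = {y. infnorm (y - x) < r}"

end

theory Submission
  imports Defs "HOL-Homology.Invariance_of_Domain"
begin

text \<open>The solutions solve a pathwise integral equation, so everything but the expectation is
  deterministic. On the interior of \<open>M\<close> the bounds on the derivatives of \<open>V\<close> give Lipschitz and
  Taylor estimates with one constant, and by invariance of domain the solutions started in \<open>K\<^sub>3\<close>
  stay in that interior. Gronwall's inequality then shows that the difference quotients of the
  solution in its initial value are Cauchy, with a rate that is uniform in \<open>\<omega>\<close>; their limit solves
  the linearised equation, and second derivatives are obtained by applying the same result to the
  equation for the pair of solution and derivative. By the uniform bounds one may differentiate
  twice under the expectation on the open set \<open>K\<^sub>3\<close>, and outside the support the function vanishes.\<close>

section \<open>Integral equations with Lipschitz coefficients\<close>

text \<open>At the points of \<open>M\<close> only partial derivatives of \<open>V\<close> are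
  given, the third ones merely bounded, and \<open>M\<close> may contain boundary points, where mean
  value arguments have no room. Hence the passage to the interior, which inherits convexity.
  Invariance of domain asks for an injective flow; injectivity is Gronwall's inequality run
  backwards in time, and it needs a Lipschitz constant on all of \<open>M\<close>, which is carried
  over from the interior by density and by continuity of \<open>V\<close>. Bounded third derivatives
  make the second ones Lipschitz, so that \<open>V\<close> and its first derivative have Taylor
  expansions with a quadratic remainder. This remainder gives the difference quotients a rate
  proportional to |r|, and the rate does most of the work: it replaces an existence theorem for the
  linearised equation, whose coefficients follow a path that may jump, and it yields continuity of
  the second derivatives as a locally uniform limit. Measurability of the derivatives in \<omega> is
  recovered only afterwards, from difference quotients.\<close>

lemma decreasing_within:
  fixes H H' :: "real \<Rightarrow> real"
  assumes "a \<le> b"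
    and "\<And>s. s \<in> {a..b} \<Longrightarrow> (H has_real_derivative H' s) (at s within {a..b})"
    and "\<And>s. s \<in> {a..b} \<Longrightarrow> H' s \<le> 0"
  shows "H b \<le> H a"
proof -
  have "\<exists>x\<in>{a..b}. H b - H a = (\<lambda>h. H' x * h) (b - a)"
    using assms(1,2) by (intro mvt_very_simple) (auto simp: has_field_derivative_def)
  then obtain x where "x \<in> {a..b}" "H b - H a = H' x * (b - a)" by auto
  thus ?thesis using assms(3)[of x] assms(1) mult_nonpos_nonneg[of "H' x" "b - a"] by simp
qed

lemma gronwall:
  fixes g :: "real \<Rightarrow> real"
  assumes "continuous_on {0..T} g" "0 \<le> L" "t \<in> {0..T}"
    and le: "\<And>s. s \<in> {0..T} \<Longrightarrow> g s \<le> a + L * integral {0..s} g"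
  shows "g t \<le> a * exp (L * t)"
proof -
  define H where "H = (\<lambda>s. (a + L * integral {0..s} g) * exp (- L * s))"
  have "H t \<le> H 0"
  proof (rule decreasing_within[where H = H])
    fix s assume s: "s \<in> {0..t}"
    have "((\<lambda>s. integral {0..s} g) has_real_derivative g s) (at s within {0..t})"
      using assms(3) s by (intro integral_has_real_derivative continuous_on_subset[OF assms(1)]) auto
    thus "(H has_real_derivative L * exp (- L * s) * (g s - (a + L * integral {0..s} g)))
        (at s within {0..t})"
      unfolding H_def by (auto intro!: derivative_eq_intros simp: algebra_simps)
    show "L * exp (- L * s) * (g s - (a + L * integral {0..s} g)) \<le> 0"
      using le[of s] s assms(2,3) by (intro mult_nonneg_nonpos) auto
  qed (use assms(3) in auto)
  hence "(a + L * integral {0..t} g) * exp (- L * t) \<le> a"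
    by (simp add: H_def)
  hence "a + L * integral {0..t} g \<le> a * exp (L * t)"
    by (simp add: exp_minus field_simps)
  thus ?thesis using le[OF assms(3)] by linarith
qed

text \<open>Gronwall backwards in time: the integrating factor is now \<open>exp (L * s)\<close>,
  and \<open>H\<close>, which vanishes at \<open>T\<close>, is nonincreasing. This serves the
  injectivity of the flow, where agreement is known at the end time.\<close>

lemma gronwall_terminal:
  fixes g :: "real \<Rightarrow> real"
  assumes "continuous_on {0..T} g" "0 \<le> L" "t \<in> {0..T}"
    and le: "\<And>s. s \<in> {0..T} \<Longrightarrow> g s \<le> L * integral {s..T} g"
  shows "g t \<le> 0"
proof -
  define H where "H = (\<lambda>s. - (integral {s..T} g) * exp (L * s))"
  have "H T \<le> H t"
  proof (rule decreasing_within[where H = H])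
    fix s assume s: "s \<in> {t..T}"
    have "((\<lambda>s. integral {s..T} g) has_real_derivative - g s) (at s within {t..T})"
      using assms(3) s by (intro integral_has_real_derivative' continuous_on_subset[OF assms(1)]) auto
    thus "(H has_real_derivative exp (L * s) * (g s - L * integral {s..T} g)) (at s within {t..T})"
      unfolding H_def by (auto intro!: derivative_eq_intros simp: algebra_simps)
    show "exp (L * s) * (g s - L * integral {s..T} g) \<le> 0"
      using le[of s] s assms(2,3) by (intro mult_nonneg_nonpos) auto
  qed (use assms(3) in auto)
  hence "integral {t..T} g \<le> 0"
    by (simp add: H_def mult_le_0_iff)
  thus ?thesis using le[OF assms(3)] assms(2) mult_nonneg_nonpos[of L "integral {t..T} g"] by linarith
qed

text \<open>The equation of \<open>solves_until\<close> on a closed interval and in any Euclidean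
  space, because the pair of a solution and its derivative lives in a product rather than in
  \<open>real^'n\<close>.\<close>

definition solves_on :: "('a::euclidean_space \<Rightarrow> 'a) \<Rightarrow> (real \<Rightarrow> 'a) \<Rightarrow> 'a \<Rightarrow> (real \<Rightarrow> 'a) \<Rightarrow> real \<Rightarrow> bool"
  where "solves_on W \<xi> p u T \<longleftrightarrow>
    (\<forall>t\<in>{0..T}. (\<lambda>s. W (u s)) integrable_on {0..t} \<and>
      u t = p + \<xi> t + integral {0..t} (\<lambda>s. W (u s)))"

text \<open>The driving path cancels, so the difference of two solutions is an indefinite integral
  and thus continuous, although each solution may jump. Every Gronwall argument on solutions rests
  on this.\<close>

lemma solves_on_diff:
  assumes "solves_on W \<xi> p u T" "solves_on W \<xi> q v T" "t \<in> {0..T}"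
  shows "(\<lambda>s. W (u s) - W (v s)) integrable_on {0..t}"
    and "u t - v t = p - q + integral {0..t} (\<lambda>s. W (u s) - W (v s))"
  using assms by (auto simp: solves_on_def integral_diff intro!: integrable_diff)

lemma solves_on_diff_continuous:
  assumes "solves_on W \<xi> p u T" "solves_on W \<xi> q v T"
  shows "continuous_on {0..T} (\<lambda>t. u t - v t)"
proof (cases "0 \<le> T")
  case True
  have "continuous_on {0..T} (\<lambda>t. p - q + integral {0..t} (\<lambda>s. W (u s) - W (v s)))"
    using solves_on_diff(1)[OF assms, of T] True
    by (intro continuous_intros indefinite_integral_continuous_1) auto
  thus ?thesis by (rule continuous_on_eq) (simp only: solves_on_diff(2)[OF assms])
qed auto

text \<open>The Lipschitz bound is required along the two solutions only, so an estimate for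
  \<open>W\<close> on a set that contains both paths suffices.\<close>

lemma solves_on_diff_le:
  assumes "solves_on W \<xi> p u T" "solves_on W \<xi> q v T" "0 \<le> L" "t \<in> {0..T}"
    and lip: "\<And>s. s \<in> {0..T} \<Longrightarrow> norm (W (u s) - W (v s)) \<le> L * norm (u s - v s)"
  shows "norm (u t - v t) \<le> norm (p - q) * exp (L * t)"
proof (rule gronwall[where T = T and g = "\<lambda>t. norm (u t - v t)"])
  show c: "continuous_on {0..T} (\<lambda>t. norm (u t - v t))"
    by (intro continuous_intros solves_on_diff_continuous[OF assms(1,2)])
  fix s assume s: "s \<in> {0..T}"
  have "norm (u s - v s) \<le> norm (p - q) + norm (integral {0..s} (\<lambda>s. W (u s) - W (v s)))"
    unfolding solves_on_diff(2)[OF assms(1,2) s] by (rule norm_triangle_ineq)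
  also have "norm (integral {0..s} (\<lambda>s. W (u s) - W (v s))) \<le> integral {0..s} (\<lambda>s. L * norm (u s - v s))"
    using s lip
    by (intro Henstock_Kurzweil_Integration.integral_norm_bound_integral
        solves_on_diff(1)[OF assms(1,2) s] integrable_continuous_interval continuous_intros
        continuous_on_subset[OF solves_on_diff_continuous[OF assms(1,2)]]) auto
  finally show "norm (u s - v s) \<le> norm (p - q) + L * integral {0..s} (\<lambda>s. norm (u s - v s))"
    by simp
qed (use assms in auto)

text \<open>If the solutions meet at time \<open>t\<close>, their difference at an earlier
  \<open>s\<close> is minus the integral over \<open>{s..t}\<close>.
  \<open>gronwall_terminal\<close> then forces it to vanish down to time 0.\<close>

lemma solves_on_inj:
  assumes "solves_on W \<xi> p u T" "solves_on W \<xi> q v T" "0 \<le> L" "t \<in> {0..T}"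
    and lip: "\<And>s. s \<in> {0..T} \<Longrightarrow> norm (W (u s) - W (v s)) \<le> L * norm (u s - v s)"
    and eq: "u t = v t"
  shows "p = q"
proof -
  note D = solves_on_diff[OF assms(1,2)]
  have c: "continuous_on {0..t} (\<lambda>t. norm (u t - v t))"
    using assms(4) by (intro continuous_intros
        continuous_on_subset[OF solves_on_diff_continuous[OF assms(1,2)]]) auto
  have "norm (u 0 - v 0) \<le> 0"
  proof (rule gronwall_terminal[where g = "\<lambda>t. norm (u t - v t)"])
    fix s assume s: "s \<in> {0..t}"
    have i: "(\<lambda>s. W (u s) - W (v s)) integrable_on {0..t}" using D(1) assms(4) by auto
    have "integral {0..s} (\<lambda>s. W (u s) - W (v s)) + integral {s..t} (\<lambda>s. W (u s) - W (v s))
      = integral {0..t} (\<lambda>s. W (u s) - W (v s))"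
      using s i by (intro Henstock_Kurzweil_Integration.integral_combine) auto
    moreover have "u s - v s = p - q + integral {0..s} (\<lambda>s. W (u s) - W (v s))"
      and "0 = p - q + integral {0..t} (\<lambda>s. W (u s) - W (v s))"
      using D(2)[of s] D(2)[of t] assms(4) s eq by auto
    ultimately have "u s - v s = - integral {s..t} (\<lambda>s. W (u s) - W (v s))"
      by (simp add: eq_neg_iff_add_eq_0 add.assoc)
    hence "norm (u s - v s) = norm (integral {s..t} (\<lambda>s. W (u s) - W (v s)))" by simp
    also have "\<dots> \<le> integral {s..t} (\<lambda>s. L * norm (u s - v s))"
      using s lip assms(4)
      by (intro Henstock_Kurzweil_Integration.integral_norm_bound_integral integrable_continuous_interval
          continuous_on_mult_left continuous_on_subset[OF c] integrable_on_subinterval[OF i]) auto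
    finally show "norm (u s - v s) \<le> L * integral {s..t} (\<lambda>s. norm (u s - v s))"
      by simp
  qed (use c assms in auto)
  moreover have "u 0 - v 0 = p - q"
    using D(2)[of 0] assms(4) by auto
  ultimately show ?thesis by simp
qed

text \<open>Meant for a limit \<open>f\<close> of which only a uniform rate of approximation is
  known; its integrability is part of the conclusion.\<close>

lemma integral_uniform_limit:
  fixes f :: "real \<Rightarrow> 'a::banach"
  assumes "a \<le> b" "(\<epsilon> \<longlonglongrightarrow> 0)"
    and g: "\<And>n. g n integrable_on {a..b}"
    and b: "\<And>n s. s \<in> {a..b} \<Longrightarrow> norm (f s - g n s) \<le> \<epsilon> n"
  shows "f integrable_on {a..b}" "(\<lambda>n. integral {a..b} (g n)) \<longlonglongrightarrow> integral {a..b} f"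
proof -
  show i: "f integrable_on {a..b}"
  proof (unfold box_real[symmetric], rule integrable_uniform_limit)
    fix e :: real assume "e > 0"
    hence "\<forall>\<^sub>F n in sequentially. \<epsilon> n < e"
      using order_tendstoD(2)[OF assms(2)] by blast
    then obtain n where "\<epsilon> n < e"
      by (auto simp: eventually_sequentially)
    thus "\<exists>g. (\<forall>x\<in>cbox a b. norm (f x - g x) \<le> e) \<and> g integrable_on cbox a b"
      using g[of n] b[of _ n] by (intro exI[of _ "g n"]) force
  qed
  have "norm (integral {a..b} (g n) - integral {a..b} f) \<le> \<epsilon> n * (b - a)" for n
  proof -
    have "norm (integral {a..b} (\<lambda>s. g n s - f s)) \<le> integral {a..b} (\<lambda>_. \<epsilon> n)"
      using b by (intro Henstock_Kurzweil_Integration.integral_norm_bound_integral integrable_diff g i)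
        (auto simp: norm_minus_commute)
    thus ?thesis using integral_diff[OF g[of n] i] assms(1) by (simp add: mult.commute)
  qed
  hence "(\<lambda>n. integral {a..b} (g n) - integral {a..b} f) \<longlonglongrightarrow> 0"
    by (intro Lim_null_comparison[OF always_eventually tendsto_mult_left_zero[OF assms(2)]]) auto
  thus "(\<lambda>n. integral {a..b} (g n)) \<longlonglongrightarrow> integral {a..b} f"
    by (rule LIM_zero_cancel)
qed

text \<open>The quotients satisfy \<open>q r t = e + integral {0..t} (w r)\<close>, where
  \<open>w r\<close> differs from the linear expression in \<open>q r\<close> by O(|r|); Gronwall
  applied to \<open>q r - q k\<close> therefore gives a bound proportional to |r| + |k|. The
  solution \<open>J\<close> of the linear equation is constructed as the limit, and the
  integrability of its right-hand side is inherited from the quotients. In \<open>lip\<close> and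
  \<open>taylor\<close> each \<open>u r\<close> is compared with \<open>u 0\<close> only, so
  \<open>I\<close> may be any open neighbourhood of 0.\<close>

lemma solves_on_differentiable:
  fixes u :: "real \<Rightarrow> real \<Rightarrow> 'a::euclidean_space" and A :: "real \<Rightarrow> 'a \<Rightarrow> 'a"
  assumes L: "0 \<le> L" and I: "open I" "0 \<in> I"
    and sol: "\<And>r. r \<in> I \<Longrightarrow> solves_on W \<xi> (p + r *\<^sub>R e) (u r) T"
    and lip: "\<And>r s. r \<in> I \<Longrightarrow> s \<in> {0..T} \<Longrightarrow>
      norm (W (u r s) - W (u 0 s)) \<le> L * norm (u r s - u 0 s)"
    and taylor: "\<And>r s. r \<in> I \<Longrightarrow> s \<in> {0..T} \<Longrightarrow>
      norm (W (u r s) - W (u 0 s) - A s (u r s - u 0 s)) \<le> L * (norm (u r s - u 0 s))\<^sup>2"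
    and lin: "\<And>s. s \<in> {0..T} \<Longrightarrow> linear (A s)"
    and bd: "\<And>s v. s \<in> {0..T} \<Longrightarrow> norm (A s v) \<le> L * norm v"
  obtains J where
    "\<And>t. t \<in> {0..T} \<Longrightarrow> (\<lambda>s. A s (J s)) integrable_on {0..t}"
    "\<And>t. t \<in> {0..T} \<Longrightarrow> J t = e + integral {0..t} (\<lambda>s. A s (J s))"
    "\<And>t. t \<in> {0..T} \<Longrightarrow> norm (J t) \<le> norm e * exp (L * T)"
    "\<And>r t. r \<in> I \<Longrightarrow> t \<in> {0..T} \<Longrightarrow> norm (u r t - u 0 t - r *\<^sub>R J t)
       \<le> L * (norm e * exp (L * T))\<^sup>2 * T * exp (L * T) * r\<^sup>2"
proof (cases "0 \<le> T")
  case False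
  thus ?thesis using that[of "\<lambda>_. 0"] by auto
next
  case T: True
  \<comment> \<open>\<open>E\<close> bounds all difference quotients,
    \<open>L * E\<^sup>2 * \<bar>r\<bar>\<close> is the Taylor error in \<open>wA\<close>, and
    \<open>T * exp (L * T)\<close> is what integrating this error over \<open>{0..T}\<close> and
    Gronwall contribute.\<close>
  define E where "E = norm e * exp (L * T)"
  define C where "C = L * E\<^sup>2 * T * exp (L * T)"
  have C0: "0 \<le> C" unfolding C_def using L T by auto
  define q where "q = (\<lambda>r t. (u r t - u 0 t) /\<^sub>R r)"
  define w where "w = (\<lambda>r t. (W (u r t) - W (u 0 t)) /\<^sub>R r)"
  have sol0: "solves_on W \<xi> p (u 0) T" using sol[OF I(2)] by simp
  have D_le: "norm (u r t - u 0 t) \<le> \<bar>r\<bar> * E" if "r \<in> I" "t \<in> {0..T}" for r t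
  proof -
    have "norm (u r t - u 0 t) \<le> norm (p + r *\<^sub>R e - p) * exp (L * t)"
      using that L lip by (intro solves_on_diff_le[OF sol sol0])
    also have "\<dots> \<le> norm (p + r *\<^sub>R e - p) * exp (L * T)"
      using that L by (intro mult_left_mono) (auto intro: mult_left_mono)
    finally show ?thesis by (simp add: E_def mult.assoc)
  qed
  have q_le: "norm (q r t) \<le> E" if "r \<in> I" "r \<noteq> 0" "t \<in> {0..T}" for r t
    using D_le[OF that(1,3)] that(2) by (simp add: q_def divide_inverse_commute[symmetric] pos_divide_le_eq mult.commute)
  have q_cont: "continuous_on {0..T} (q r)" if "r \<in> I" for r
    unfolding q_def by (intro continuous_intros solves_on_diff_continuous[OF sol[OF that] sol0])
  have w_int: "w r integrable_on {0..t}" if "r \<in> I" "t \<in> {0..T}" for r t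
    unfolding w_def by (intro integrable_cmul solves_on_diff(1)[OF sol[OF that(1)] sol0 that(2)])
  have q_eq: "q r t = e + integral {0..t} (w r)" if "r \<in> I" "r \<noteq> 0" "t \<in> {0..T}" for r t
    using that(2) unfolding q_def w_def solves_on_diff(2)[OF sol[OF that(1)] sol0 that(3)]
    by (simp add: scaleR_add_right)
  have wA: "norm (w r s - A s (q r s)) \<le> L * E\<^sup>2 * \<bar>r\<bar>" if "r \<in> I" "r \<noteq> 0" "s \<in> {0..T}" for r s
  proof -
    have "w r s - A s (q r s) = (W (u r s) - W (u 0 s) - A s (u r s - u 0 s)) /\<^sub>R r"
      unfolding w_def q_def linear_scale[OF lin[OF that(3)]] by (simp only: scaleR_diff_right)
    also have "norm \<dots> \<le> (L * (\<bar>r\<bar> * E)\<^sup>2) / \<bar>r\<bar>"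
    proof -
      have "norm (W (u r s) - W (u 0 s) - A s (u r s - u 0 s)) \<le> L * (\<bar>r\<bar> * E)\<^sup>2"
        by (intro order.trans[OF taylor[OF that(1,3)]] mult_left_mono power_mono D_le that L norm_ge_zero)
      thus ?thesis using that(2) by (simp add: divide_inverse_commute mult_left_mono)
    qed
    also have "\<dots> = L * E\<^sup>2 * \<bar>r\<bar>"
      using that(2) by (simp add: power2_eq_square field_simps)
    finally show ?thesis .
  qed
  have q_diff: "norm (q r t - q k t) \<le> C * (\<bar>r\<bar> + \<bar>k\<bar>)"
    if "r \<in> I" "r \<noteq> 0" "k \<in> I" "k \<noteq> 0" "t \<in> {0..T}" for r k t
  proof -
    define B where "B = L * E\<^sup>2 * (\<bar>r\<bar> + \<bar>k\<bar>)"
    have B0: "0 \<le> B" using L by (simp add: B_def)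
    have c: "continuous_on {0..T} (\<lambda>t. norm (q r t - q k t))"
      by (intro continuous_intros q_cont that)
    have "norm (q r t - q k t) \<le> B * T * exp (L * t)"
    proof (rule gronwall[OF c L that(5)])
      fix s assume s: "s \<in> {0..T}"
      have "q r s - q k s = integral {0..s} (\<lambda>s. w r s - w k s)"
        using q_eq[OF that(1,2) s] q_eq[OF that(3,4) s] integral_diff[OF w_int w_int] that s by simp
      also have "norm \<dots> \<le> integral {0..s} (\<lambda>s. L * norm (q r s - q k s) + B)"
      proof (intro Henstock_Kurzweil_Integration.integral_norm_bound_integral integrable_diff w_int that s
          integrable_continuous_interval continuous_on_add continuous_on_mult_left continuous_on_const
          continuous_on_subset[OF c])
        fix x assume "x \<in> {0..s}"
        hence x: "x \<in> {0..T}" using s by auto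
        \<comment> \<open>Both quotients are linearised by the same operator \<open>A x\<close>: the
          linear part enters Gronwall with the constant \<open>L\<close>, and the two Taylor errors
          add up to \<open>B\<close>.\<close>
        have "w r x - w k x = A x (q r x - q k x)
            + (w r x - A x (q r x)) - (w k x - A x (q k x))"
          by (simp add: linear_diff[OF lin[OF x]])
        also have "norm \<dots> \<le> norm (A x (q r x - q k x))
            + norm (w r x - A x (q r x)) + norm (w k x - A x (q k x))"
          by (intro order.trans[OF norm_triangle_ineq4] add_mono norm_triangle_ineq order.refl)
        finally show "norm (w r x - w k x) \<le> L * norm (q r x - q k x) + B"
          using bd[OF x, of "q r x - q k x"] wA[OF that(1,2) x] wA[OF that(3,4) x]
          by (simp add: B_def distrib_left)
      qed (use s in auto)
      also have "\<dots> = L * integral {0..s} (\<lambda>s. norm (q r s - q k s)) + B * s"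
        using s by (subst Henstock_Kurzweil_Integration.integral_add)
          (auto intro!: integrable_continuous_interval continuous_on_mult_left continuous_on_subset[OF c])
      also have "\<dots> \<le> B * T + L * integral {0..s} (\<lambda>s. norm (q r s - q k s))"
        using s B0 by (simp add: mult_left_mono)
      finally show "norm (q r s - q k s) \<le> B * T + L * integral {0..s} (\<lambda>s. norm (q r s - q k s))" .
    qed
    also have "\<dots> \<le> B * T * exp (L * T)"
      using B0 T L that by (intro mult_left_mono) (auto intro: mult_left_mono)
    finally show ?thesis by (simp add: B_def C_def algebra_simps)
  qed
  obtain \<delta> where \<delta>: "\<delta> > 0" "ball 0 \<delta> \<subseteq> I"
    using I open_contains_ball by blast
  \<comment> \<open>With \<open>n + 2\<close> in the denominator already \<open>h 0\<close> lies
    strictly inside the open ball of radius \<delta>.\<close>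
  define h where "h = (\<lambda>n::nat. \<delta> / real (n + 2))"
  have h: "h n \<in> I" "h n \<noteq> 0" "h n > 0" for n
  proof -
    have "h n < \<delta>" using \<delta> by (simp add: h_def field_simps add_pos_nonneg)
    moreover show "h n > 0" using \<delta> by (simp add: h_def)
    ultimately show "h n \<in> I" "h n \<noteq> 0" using \<delta> by (auto simp: subset_iff)
  qed
  have h0: "h \<longlonglongrightarrow> 0"
    unfolding h_def using LIMSEQ_ignore_initial_segment[OF lim_const_over_n[of \<delta>], of 2] by simp
  have "convergent (\<lambda>n. q (h n) t)" if t: "t \<in> {0..T}" for t
  proof (intro Cauchy_convergent CauchyI)
    fix \<epsilon> :: real assume "\<epsilon> > 0"
    have "(\<lambda>n. C * h n) \<longlonglongrightarrow> 0" using tendsto_mult_right_zero[OF h0] .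
    hence "\<forall>\<^sub>F n in sequentially. C * h n < \<epsilon> / 2"
      using \<open>\<epsilon> > 0\<close> by (intro order_tendstoD(2)) auto
    then obtain N where N: "\<And>n. n \<ge> N \<Longrightarrow> C * h n < \<epsilon> / 2"
      by (auto simp: eventually_sequentially)
    show "\<exists>M. \<forall>m\<ge>M. \<forall>n\<ge>M. norm (q (h m) t - q (h n) t) < \<epsilon>"
    proof (intro exI[of _ N] allI impI)
      fix m n assume "m \<ge> N" "n \<ge> N"
      thus "norm (q (h m) t - q (h n) t) < \<epsilon>"
        using q_diff[OF h(1,2) h(1,2) t, of m n] N[of m] N[of n] h(3)[of m] h(3)[of n]
        by (simp add: distrib_left)
    qed
  qed
  define J where "J = (\<lambda>t. lim (\<lambda>n. q (h n) t))"
  have J: "(\<lambda>n. q (h n) t) \<longlonglongrightarrow> J t" if "t \<in> {0..T}" for t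
    using \<open>t \<in> {0..T} \<Longrightarrow> convergent (\<lambda>n. q (h n) t)\<close> that
    by (simp add: J_def convergent_LIMSEQ_iff)
  \<comment> \<open>Letting \<open>k\<close> run through \<open>h n\<close> in \<open>q_diff\<close>
    gives the rate for every \<open>r\<close>, not only along the chosen sequence.\<close>
  have qJ: "norm (q r t - J t) \<le> C * \<bar>r\<bar>" if "r \<in> I" "r \<noteq> 0" "t \<in> {0..T}" for r t
  proof (rule tendsto_le[OF _ _ _ always_eventually])
    show "(\<lambda>n. norm (q r t - q (h n) t)) \<longlonglongrightarrow> norm (q r t - J t)"
      by (intro tendsto_intros J that)
    have "(\<lambda>n. C * (\<bar>r\<bar> + \<bar>h n\<bar>)) \<longlonglongrightarrow> C * (\<bar>r\<bar> + \<bar>0\<bar>)"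
      by (intro tendsto_intros h0)
    thus "(\<lambda>n. C * (\<bar>r\<bar> + \<bar>h n\<bar>)) \<longlonglongrightarrow> C * \<bar>r\<bar>" by simp
  qed (use q_diff[OF that(1,2) h(1,2) that(3)] in auto)
  \<comment> \<open>Replacing \<open>q (h n)\<close> by \<open>J\<close> costs \<open>L * C\<close>
    and linearising costs \<open>L * E\<^sup>2\<close>, each times \<open>h n\<close>. The
    integrands thus converge uniformly in \<open>s\<close>, and the integral equation passes to the
    limit.\<close>
  have wJ: "norm (A s (J s) - w (h n) s) \<le> (L * C + L * E\<^sup>2) * h n" if s: "s \<in> {0..T}" for s n
  proof -
    have "A s (J s) - w (h n) s = - A s (q (h n) s - J s) - (w (h n) s - A s (q (h n) s))"
      by (simp add: linear_diff[OF lin[OF s]])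
    also have "norm \<dots> \<le> norm (A s (q (h n) s - J s)) + norm (w (h n) s - A s (q (h n) s))"
      by (metis norm_triangle_ineq4 norm_minus_cancel)
    also have "\<dots> \<le> L * (C * \<bar>h n\<bar>) + L * E\<^sup>2 * \<bar>h n\<bar>"
      by (intro add_mono wA h(1,2) s order.trans[OF bd[OF s]] mult_left_mono[OF qJ L])
    finally show ?thesis using h(3)[of n] by (simp add: algebra_simps)
  qed
  have lim0: "(\<lambda>n. (L * C + L * E\<^sup>2) * h n) \<longlonglongrightarrow> 0"
    using tendsto_mult_right_zero[OF h0] .
  show ?thesis
  proof (rule that)
    fix t assume t: "t \<in> {0..T}"
    have wJ': "norm (A s (J s) - w (h n) s) \<le> (L * C + L * E\<^sup>2) * h n" if "s \<in> {0..t}" for s n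
      using wJ t that by auto
    note lims = integral_uniform_limit[where f = "\<lambda>s. A s (J s)" and g = "\<lambda>n. w (h n)",
        OF _ lim0 w_int[OF h(1) t] wJ']
    show "(\<lambda>s. A s (J s)) integrable_on {0..t}"
      using lims(1) t by auto
    have "(\<lambda>n. q (h n) t) \<longlonglongrightarrow> e + integral {0..t} (\<lambda>s. A s (J s))"
      unfolding q_eq[OF h(1,2) t] using lims(2) t by (intro tendsto_intros) auto
    thus "J t = e + integral {0..t} (\<lambda>s. A s (J s))"
      using J[OF t] LIMSEQ_unique by blast
    show "norm (J t) \<le> norm e * exp (L * T)"
      using q_le[OF h(1,2) t] unfolding E_def
      by (intro tendsto_upperbound[OF tendsto_norm[OF J[OF t]] always_eventually]) auto
  next
    fix r t assume r: "r \<in> I" and t: "t \<in> {0..T}"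
    have "norm (u r t - u 0 t - r *\<^sub>R J t) \<le> C * r\<^sup>2"
    proof (cases "r = 0")
      case False
      have "u r t - u 0 t - r *\<^sub>R J t = r *\<^sub>R (q r t - J t)"
        using False by (simp add: q_def scaleR_diff_right)
      hence "norm (u r t - u 0 t - r *\<^sub>R J t) = \<bar>r\<bar> * norm (q r t - J t)" by simp
      also have "\<dots> \<le> \<bar>r\<bar> * (C * \<bar>r\<bar>)"
        by (intro mult_left_mono qJ r t False) auto
      finally show ?thesis by (simp add: power2_eq_square algebra_simps)
    qed simp
    thus "norm (u r t - u 0 t - r *\<^sub>R J t)
       \<le> L * (norm e * exp (L * T))\<^sup>2 * T * exp (L * T) * r\<^sup>2"
      by (simp add: C_def E_def)
  qed
qed

section \<open>Second derivatives of the flow\<close>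

lemma open_line_preimage:
  fixes x e :: "'a::real_normed_vector"
  assumes "open U"
  shows "open {s. x + s *\<^sub>R e \<in> U}"
proof -
  have "continuous_on UNIV (\<lambda>s. x + s *\<^sub>R e)" by (intro continuous_intros)
  from open_vimage[OF assms this] show ?thesis by (simp add: vimage_def)
qed

lemma has_integral_Pair:
  fixes f :: "'c::euclidean_space \<Rightarrow> 'a::euclidean_space" and g :: "'c \<Rightarrow> 'b::euclidean_space"
  assumes "(f has_integral a) S" "(g has_integral b) S"
  shows "((\<lambda>x. (f x, g x)) has_integral (a, b)) S"
proof -
  have "bounded_linear (\<lambda>x::'a. (x, 0::'b))" "bounded_linear (\<lambda>x::'b. (0::'a, x))"
    by (auto intro!: bounded_linear_Pair bounded_linear_ident bounded_linear_zero)
  from has_integral_add[OF has_integral_linear[OF assms(1) this(1)] has_integral_linear[OF assms(2) this(2)]]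
  show ?thesis by (simp add: o_def)
qed

text \<open>\<open>V1 a\<close> and \<open>V2 a\<close> stand for the first two derivatives at
  \<open>a\<close>; in \<open>V2 a h v\<close> the direction \<open>h\<close> is the one
  differentiated last, with \<open>v\<close> a parameter, whence the linearity in \<open>h\<close>.
  The list is what \<open>solves_on_differentiable\<close> demands of \<open>V\<close> and, for
  bounded vectors, of its tangent field. The last estimate is the place where third derivatives
  enter.\<close>

definition C2_estimates ::
  "'a::euclidean_space set \<Rightarrow> real \<Rightarrow> ('a \<Rightarrow> 'a) \<Rightarrow> ('a \<Rightarrow> 'a \<Rightarrow> 'a) \<Rightarrow> ('a \<Rightarrow> 'a \<Rightarrow> 'a \<Rightarrow> 'a) \<Rightarrow> bool"
  where "C2_estimates S L V V1 V2 \<longleftrightarrow> 0 \<le> L \<and>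
    (\<forall>a\<in>S. linear (V1 a) \<and> (\<forall>v. linear (\<lambda>h. V2 a h v)) \<and>
      (\<forall>v. norm (V1 a v) \<le> L * norm v) \<and>
      (\<forall>h v. norm (V2 a h v) \<le> L * norm h * norm v) \<and>
      (\<forall>b\<in>S. norm (V b - V a) \<le> L * norm (b - a) \<and>
        norm (V b - V a - V1 a (b - a)) \<le> L * (norm (b - a))\<^sup>2 \<and>
        (\<forall>v. norm (V1 b v - V1 a v) \<le> L * norm (b - a) * norm v \<and>
          norm (V1 b v - V1 a v - V2 a (b - a) v) \<le> L * (norm (b - a))\<^sup>2 * norm v)))"

lemma C2_estimatesD:
  assumes "C2_estimates S L V V1 V2" "a \<in> S"
  shows "0 \<le> L" "linear (V1 a)" "linear (\<lambda>h. V2 a h v)"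
    "norm (V1 a v) \<le> L * norm v" "norm (V2 a h v) \<le> L * norm h * norm v"
    "b \<in> S \<Longrightarrow> norm (V b - V a) \<le> L * norm (b - a)"
    "b \<in> S \<Longrightarrow> norm (V b - V a - V1 a (b - a)) \<le> L * (norm (b - a))\<^sup>2"
    "b \<in> S \<Longrightarrow> norm (V1 b v - V1 a v) \<le> L * norm (b - a) * norm v"
    "b \<in> S \<Longrightarrow> norm (V1 b v - V1 a v - V2 a (b - a) v) \<le> L * (norm (b - a))\<^sup>2 * norm v"
  using assms unfolding C2_estimates_def by blast+

text \<open>A solution together with its derivative in the initial value solves the equation for the
  tangent field, so that second derivatives of the flow are first derivatives of the tangent flow.\<close>

definition tangent_field :: "('a \<Rightarrow> 'a) \<Rightarrow> ('a \<Rightarrow> 'a \<Rightarrow> 'a) \<Rightarrow> 'a \<times> 'a \<Rightarrow> 'a \<times> 'a"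
  where "tangent_field V V1 = (\<lambda>(a, v). (V a, V1 a v))"

text \<open>Product rule for the map taking (a, v) to \<open>V1 a v\<close>, which is linear in
  \<open>v\<close>.\<close>

definition tangent_field_deriv ::
  "('a \<Rightarrow> 'a \<Rightarrow> 'a) \<Rightarrow> ('a \<Rightarrow> 'a \<Rightarrow> 'a \<Rightarrow> 'a) \<Rightarrow> 'a \<times> 'a \<Rightarrow> 'a \<times> 'a \<Rightarrow> ('a::plus) \<times> 'a"
  where "tangent_field_deriv V1 V2 = (\<lambda>(a, v) (h, k). (V1 a h, V2 a h v + V1 a k))"

text \<open>The bound on \<open>V1 b v - V1 a v\<close> grows with \<open>v\<close>, so the field is
  controlled only where the vector is bounded; this is the term \<open>L * R\<close>. Splitting into
  a change of vector at the base point \<open>b\<close> and a change of base point at the fixed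
  vector \<open>v\<close> makes a bound at the single point \<open>p\<close> enough.\<close>

lemma tangent_field_estimates:
  fixes V :: "'a::euclidean_space \<Rightarrow> 'a"
  assumes est: "C2_estimates S L V V1 V2"
    and p: "fst p \<in> S" "norm (snd p) \<le> R" and q: "fst q \<in> S"
  defines "L' \<equiv> 2 * L + L * R"
  shows "linear (tangent_field_deriv V1 V2 p)"
    and "norm (tangent_field_deriv V1 V2 p d) \<le> L' * norm d"
    and "norm (tangent_field V V1 q - tangent_field V V1 p) \<le> L' * norm (q - p)"
    and "norm (tangent_field V V1 q - tangent_field V V1 p - tangent_field_deriv V1 V2 p (q - p))
      \<le> L' * (norm (q - p))\<^sup>2"
proof -
  obtain a v where p_eq: "p = (a, v)" by force
  obtain b w where q_eq: "q = (b, w)" by force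
  have a: "a \<in> S" and b: "b \<in> S" and v: "norm v \<le> R" using p q by (auto simp: p_eq q_eq)
  note D = C2_estimatesD[OF est a]
  have R: "0 \<le> R" using v norm_ge_zero[of v] by linarith
  show "linear (tangent_field_deriv V1 V2 p)"
    by (rule linearI) (auto simp: p_eq tangent_field_deriv_def linear_add[OF D(2)] linear_add[OF D(3)]
        linear_scale[OF D(2)] linear_scale[OF D(3)] algebra_simps)
  show "norm (tangent_field_deriv V1 V2 p d) \<le> L' * norm d"
  proof -
    obtain h k where d: "d = (h, k)" by force
    have hk: "norm h \<le> norm d" "norm k \<le> norm d"
      using norm_fst_le[of h k] norm_snd_le[of k h] d by auto
    have "norm (tangent_field_deriv V1 V2 p d) \<le> norm (V1 a h) + (norm (V2 a h v) + norm (V1 a k))"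
      by (auto simp: d p_eq tangent_field_deriv_def intro!: order.trans[OF norm_Pair_le] norm_triangle_ineq)
    also have "\<dots> \<le> L * norm d + (L * norm d * R + L * norm d)"
      using D(1) R hk v
      by (intro add_mono order.trans[OF D(4)] order.trans[OF D(5)] mult_mono) auto
    finally show ?thesis by (simp add: L'_def algebra_simps)
  qed
  have le: "norm (b - a) \<le> norm (q - p)" "norm (w - v) \<le> norm (q - p)"
    using norm_fst_le[of "b - a" "w - v"] norm_snd_le[of "w - v" "b - a"] by (auto simp: p_eq q_eq)
  show "norm (tangent_field V V1 q - tangent_field V V1 p) \<le> L' * norm (q - p)"
  proof -
    have "V1 b w - V1 a v = V1 b (w - v) + (V1 b v - V1 a v)"
      by (simp add: linear_diff[OF C2_estimatesD(2)[OF est b]])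
    hence "norm (V1 b w - V1 a v) \<le> norm (V1 b (w - v)) + norm (V1 b v - V1 a v)"
      by (simp only: norm_triangle_ineq)
    hence "norm (tangent_field V V1 q - tangent_field V V1 p)
        \<le> norm (V b - V a) + (norm (V1 b (w - v)) + norm (V1 b v - V1 a v))"
      by (auto simp: p_eq q_eq tangent_field_def intro!: order.trans[OF norm_Pair_le])
    also have "\<dots> \<le> L * norm (q - p) + (L * norm (q - p) + L * norm (q - p) * R)"
      using D(1) R le v
      by (intro add_mono order.trans[OF C2_estimatesD(4)[OF est b]] order.trans[OF D(6)[OF b]]
          order.trans[OF D(8)[OF b]] mult_mono) auto
    finally show ?thesis by (simp add: L'_def algebra_simps)
  qed
  show "norm (tangent_field V V1 q - tangent_field V V1 p - tangent_field_deriv V1 V2 p (q - p))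
      \<le> L' * (norm (q - p))\<^sup>2"
  proof -
    \<comment> \<open>The first summand is governed by a product of two differences and so is
      already quadratic; the second is the Taylor error of \<open>V1\<close>.\<close>
    have "V1 b w - V1 a v - (V2 a (b - a) v + V1 a (w - v))
      = (V1 b (w - v) - V1 a (w - v)) + (V1 b v - V1 a v - V2 a (b - a) v)"
      by (simp add: linear_diff[OF C2_estimatesD(2)[OF est b]] linear_diff[OF D(2)])
    hence "norm (V1 b w - V1 a v - (V2 a (b - a) v + V1 a (w - v)))
        \<le> norm (V1 b (w - v) - V1 a (w - v)) + norm (V1 b v - V1 a v - V2 a (b - a) v)"
      by (simp only: norm_triangle_ineq)
    hence "norm (tangent_field V V1 q - tangent_field V V1 p - tangent_field_deriv V1 V2 p (q - p))
        \<le> norm (V b - V a - V1 a (b - a)) +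
          (norm (V1 b (w - v) - V1 a (w - v)) + norm (V1 b v - V1 a v - V2 a (b - a) v))"
      by (auto simp: p_eq q_eq tangent_field_def tangent_field_deriv_def
          intro!: order.trans[OF norm_Pair_le])
    also have "\<dots> \<le> L * (norm (q - p))\<^sup>2 + (L * norm (q - p) * norm (q - p) + L * (norm (q - p))\<^sup>2 * R)"
      using D(1) R le v
      by (intro add_mono order.trans[OF D(7)[OF b]] order.trans[OF D(8)[OF b]]
          order.trans[OF D(9)[OF b]] mult_mono power_mono) auto
    finally show ?thesis by (simp add: L'_def power2_eq_square algebra_simps)
  qed
qed

text \<open>The two constants that \<open>solves_on_differentiable\<close> delivers for a unit
  direction, the bound on the derivative and the factor of the quadratic error, added so that one
  number majorises both.\<close>

definition flow_bound :: "real \<Rightarrow> real \<Rightarrow> real"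
  where "flow_bound L T = exp (L * T) + L * (exp (L * T))\<^sup>2 * T * exp (L * T)"

lemma flow_bound_ge:
  assumes "0 \<le> L" "0 \<le> T"
  shows "exp (L * T) \<le> flow_bound L T" "L * (exp (L * T))\<^sup>2 * T * exp (L * T) \<le> flow_bound L T"
    "0 \<le> flow_bound L T"
  using assms by (auto simp: flow_bound_def)

text \<open>\<open>J e x\<close> is the derivative of the flow at \<open>x\<close> in the direction
  \<open>e\<close>, and \<open>H e' e x\<close> that of \<open>J e\<close> in the direction
  \<open>e'\<close>. The summands of \<open>C\<close> belong to the equation and to its tangent
  equation; the Lipschitz constant of the latter contains \<open>exp (L * T)\<close>, the bound on
  \<open>J e x\<close> for a unit vector \<open>e\<close>.\<close>

lemma flow_C2:
  fixes V :: "'a::euclidean_space \<Rightarrow> 'a" and y :: "'a \<Rightarrow> real \<Rightarrow> 'a"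
  assumes est: "C2_estimates S L V V1 V2" and T: "0 \<le> T" and L: "0 \<le> L" and U: "open U"
    and sol: "\<And>x. x \<in> U \<Longrightarrow> solves_on V \<xi> x (y x) T"
    and S: "\<And>x s. x \<in> U \<Longrightarrow> s \<in> {0..T} \<Longrightarrow> y x s \<in> S"
  defines "C \<equiv> flow_bound L T + flow_bound (2 * L + L * exp (L * T)) T"
  obtains J H where
    "\<And>x z t. x \<in> U \<Longrightarrow> z \<in> U \<Longrightarrow> t \<in> {0..T} \<Longrightarrow> norm (y z t - y x t) \<le> C * norm (z - x)"
    "\<And>e x t. x \<in> U \<Longrightarrow> t \<in> {0..T} \<Longrightarrow> norm e = 1 \<Longrightarrow> norm (J e x t) \<le> C"
    "\<And>e x t r. x \<in> U \<Longrightarrow> x + r *\<^sub>R e \<in> U \<Longrightarrow> t \<in> {0..T} \<Longrightarrow> norm e = 1 \<Longrightarrow>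
      norm (y (x + r *\<^sub>R e) t - y x t - r *\<^sub>R J e x t) \<le> C * r\<^sup>2"
    "\<And>e x z t. x \<in> U \<Longrightarrow> z \<in> U \<Longrightarrow> t \<in> {0..T} \<Longrightarrow> norm e = 1 \<Longrightarrow>
      norm (J e z t - J e x t) \<le> C * norm (z - x)"
    "\<And>e e' x t. x \<in> U \<Longrightarrow> t \<in> {0..T} \<Longrightarrow> norm e = 1 \<Longrightarrow> norm e' = 1 \<Longrightarrow> norm (H e' e x t) \<le> C"
    "\<And>e e' x t r. x \<in> U \<Longrightarrow> x + r *\<^sub>R e' \<in> U \<Longrightarrow> t \<in> {0..T} \<Longrightarrow> norm e = 1 \<Longrightarrow> norm e' = 1 \<Longrightarrow>
      norm (J e (x + r *\<^sub>R e') t - J e x t - r *\<^sub>R H e' e x t) \<le> C * r\<^sup>2"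
proof -
  define R where "R = exp (L * T)"
  define L' where "L' = 2 * L + L * R"
  have L': "0 \<le> L'" using L by (simp add: L'_def R_def)
  note fb = flow_bound_ge[OF L T] flow_bound_ge[OF L' T]
  have C: "flow_bound L T \<le> C" "flow_bound L' T \<le> C"
    using fb by (auto simp: C_def L'_def R_def)
  \<comment> \<open>Besides the derivative estimate, \<open>P\<close> records the linearised
    equation, because \<open>J\<close> has to serve as one half of a solution of the tangent
    equation.\<close>
  define P where "P = (\<lambda>e x J. \<forall>t\<in>{0..T}. (\<lambda>s. V1 (y x s) (J s)) integrable_on {0..t} \<and>
       J t = e + integral {0..t} (\<lambda>s. V1 (y x s) (J s)) \<and> norm (J t) \<le> R \<and>
       (\<forall>r. x + r *\<^sub>R e \<in> U \<longrightarrow> norm (y (x + r *\<^sub>R e) t - y x t - r *\<^sub>R J t) \<le> flow_bound L T * r\<^sup>2))"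
  have "\<exists>J. P e x J"
    if x: "x \<in> U" and e: "norm e = 1" for x e
  proof (rule solves_on_differentiable[OF L open_line_preimage[OF U, of x e], where u = "\<lambda>r. y (x + r *\<^sub>R e)"
        and A = "\<lambda>s. V1 (y x s)" and T = T and p = x and e = e and W = V and \<xi> = \<xi>])
    fix J
    assume J: "\<And>t. t \<in> {0..T} \<Longrightarrow> (\<lambda>s. V1 (y x s) (J s)) integrable_on {0..t}"
      "\<And>t. t \<in> {0..T} \<Longrightarrow> J t = e + integral {0..t} (\<lambda>s. V1 (y x s) (J s))"
      "\<And>t. t \<in> {0..T} \<Longrightarrow> norm (J t) \<le> norm e * exp (L * T)"
      "\<And>r t. r \<in> {r. x + r *\<^sub>R e \<in> U} \<Longrightarrow> t \<in> {0..T} \<Longrightarrow> norm (y (x + r *\<^sub>R e) t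
        - y (x + 0 *\<^sub>R e) t - r *\<^sub>R J t) \<le> L * (norm e * exp (L * T))\<^sup>2 * T * exp (L * T) * r\<^sup>2"
    have "norm (y (x + r *\<^sub>R e) t - y x t - r *\<^sub>R J t) \<le> flow_bound L T * r\<^sup>2"
      if "t \<in> {0..T}" "x + r *\<^sub>R e \<in> U" for t r
      using J(4)[of r t] that e mult_right_mono[OF fb(2), of "r\<^sup>2"] by auto
    with J(1-3) e show ?thesis unfolding P_def by (intro exI[of _ J]) (simp add: R_def)
  next
    fix r s assume r: "r \<in> {r. x + r *\<^sub>R e \<in> U}"
    thus "solves_on V \<xi> (x + r *\<^sub>R e) (y (x + r *\<^sub>R e)) T" using sol by simp
    assume s: "s \<in> {0..T}"
    have in_S: "y x s \<in> S" "y (x + r *\<^sub>R e) s \<in> S" using S x r s by auto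
    show "norm (V (y (x + r *\<^sub>R e) s) - V (y (x + 0 *\<^sub>R e) s))
        \<le> L * norm (y (x + r *\<^sub>R e) s - y (x + 0 *\<^sub>R e) s)"
      using C2_estimatesD(6)[OF est in_S] by simp
    show "norm (V (y (x + r *\<^sub>R e) s) - V (y (x + 0 *\<^sub>R e) s)
          - V1 (y x s) (y (x + r *\<^sub>R e) s - y (x + 0 *\<^sub>R e) s))
        \<le> L * (norm (y (x + r *\<^sub>R e) s - y (x + 0 *\<^sub>R e) s))\<^sup>2"
      using C2_estimatesD(7)[OF est in_S] by simp
  next
    fix s v assume s: "s \<in> {0..T}"
    show "linear (V1 (y x s))" "norm (V1 (y x s) v) \<le> L * norm v"
      using C2_estimatesD(2,4)[OF est S[OF x s]] by auto
  qed (use x in simp)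
  hence ex_J: "P e x (SOME J. P e x J)" if "x \<in> U" "norm e = 1" for x e
    using that by (simp add: someI_ex)
  define J where "J = (\<lambda>e x. SOME J. P e x J)"
  have J: "(\<lambda>s. V1 (y x s) (J e x s)) integrable_on {0..t} \<and>
       J e x t = e + integral {0..t} (\<lambda>s. V1 (y x s) (J e x s)) \<and> norm (J e x t) \<le> R \<and>
       (\<forall>r. x + r *\<^sub>R e \<in> U \<longrightarrow> norm (y (x + r *\<^sub>R e) t - y x t - r *\<^sub>R J e x t) \<le> flow_bound L T * r\<^sup>2)"
    if "x \<in> U" "norm e = 1" "t \<in> {0..T}" for e x t
    using ex_J[OF that(1,2)] that(3) unfolding P_def J_def by blast
  have J_le: "norm (J e x t) \<le> R" if "x \<in> U" "norm e = 1" "t \<in> {0..T}" for e x t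
    using J[OF that] by blast
  define z where "z = (\<lambda>e x t. (y x t, J e x t))"
  define W where "W = tangent_field V V1"
  \<comment> \<open>The driving path does not depend on the initial value, so its derivative
    contributes 0, and \<open>J e x\<close> starts at \<open>e\<close>.\<close>
  have z_sol: "solves_on W (\<lambda>t. (\<xi> t, 0)) (x, e) (z e x) T" if "x \<in> U" "norm e = 1" for x e
    unfolding solves_on_def
  proof
    fix t assume t: "t \<in> {0..T}"
    have 1: "(\<lambda>s. V (y x s)) integrable_on {0..t}" "y x t = x + \<xi> t + integral {0..t} (\<lambda>s. V (y x s))"
      using sol[OF that(1)] t by (auto simp: solves_on_def)
    have 2: "(\<lambda>s. V1 (y x s) (J e x s)) integrable_on {0..t}"
       "J e x t = e + integral {0..t} (\<lambda>s. V1 (y x s) (J e x s))"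
      using J[OF that t] by auto
    have "((\<lambda>s. W (z e x s)) has_integral (integral {0..t} (\<lambda>s. V (y x s)),
        integral {0..t} (\<lambda>s. V1 (y x s) (J e x s)))) {0..t}"
      using has_integral_Pair[OF integrable_integral[OF 1(1)] integrable_integral[OF 2(1)]]
      by (simp add: W_def z_def tangent_field_def)
    thus "(\<lambda>s. W (z e x s)) integrable_on {0..t} \<and>
        z e x t = (x, e) + (\<xi> t, 0) + integral {0..t} (\<lambda>s. W (z e x s))"
      using 1(2) 2(2) by (auto simp: z_def integral_unique)
  qed
  have z_in: "fst (z e x s) \<in> S" "norm (snd (z e x s)) \<le> R"
    if "x \<in> U" "norm e = 1" "s \<in> {0..T}" for x e s
    using S[OF that(1,3)] J_le[OF that] by (simp_all add: z_def)
  note z_est = tangent_field_estimates[OF est z_in z_in(1), folded W_def L'_def]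
  define Q where "Q = (\<lambda>e' e x K. \<forall>t\<in>{0..T}. norm (K t) \<le> C \<and> (\<forall>r. x + r *\<^sub>R e' \<in> U \<longrightarrow>
      norm (z e (x + r *\<^sub>R e') t - z e x t - r *\<^sub>R K t) \<le> C * r\<^sup>2))"
  \<comment> \<open>Moving \<open>x\<close> along \<open>e'\<close> leaves the starting vector
    \<open>e\<close> of the second component unchanged, hence the direction
    \<open>(e', 0)\<close>.\<close>
  have "\<exists>K. Q e' e x K"
    if x: "x \<in> U" and e: "norm e = 1" and e': "norm e' = 1" for x e e'
  proof (rule solves_on_differentiable[OF L' open_line_preimage[OF U, of x e'], where u = "\<lambda>r. z e (x + r *\<^sub>R e')"
        and A = "\<lambda>s. tangent_field_deriv V1 V2 (z e x s)" and T = T and p = "(x, e)" and e = "(e', 0)"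
        and W = W and \<xi> = "\<lambda>t. (\<xi> t, 0)"])
    fix K
    assume K: "\<And>t. t \<in> {0..T} \<Longrightarrow> norm (K t) \<le> norm (e', 0 :: 'a) * exp (L' * T)"
      "\<And>r t. r \<in> {r. x + r *\<^sub>R e' \<in> U} \<Longrightarrow> t \<in> {0..T} \<Longrightarrow> norm (z e (x + r *\<^sub>R e') t
        - z e (x + 0 *\<^sub>R e') t - r *\<^sub>R K t)
        \<le> L' * (norm (e', 0 :: 'a) * exp (L' * T))\<^sup>2 * T * exp (L' * T) * r\<^sup>2"
    have n: "norm (e', 0 :: 'a) = 1" using e' by (simp add: norm_Pair)
    have "norm (K t) \<le> C" if "t \<in> {0..T}" for t
      using K(1)[OF that] fb(4) C unfolding n by linarith
    moreover have "norm (z e (x + r *\<^sub>R e') t - z e x t - r *\<^sub>R K t) \<le> C * r\<^sup>2"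
      if "t \<in> {0..T}" "x + r *\<^sub>R e' \<in> U" for t r
    proof -
      have "norm (z e (x + r *\<^sub>R e') t - z e x t - r *\<^sub>R K t)
          \<le> L' * (exp (L' * T))\<^sup>2 * T * exp (L' * T) * r\<^sup>2"
        using K(2)[of r t] that unfolding n by simp
      also have "\<dots> \<le> C * r\<^sup>2" using fb(5) C by (intro mult_right_mono) auto
      finally show ?thesis .
    qed
    ultimately show ?thesis unfolding Q_def by blast
  next
    fix r s assume r: "r \<in> {r. x + r *\<^sub>R e' \<in> U}"
    thus "solves_on W (\<lambda>t. (\<xi> t, 0)) ((x, e) + r *\<^sub>R (e', 0)) (z e (x + r *\<^sub>R e')) T"
      using z_sol[OF _ e, of "x + r *\<^sub>R e'"] by simp
    assume s: "s \<in> {0..T}"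
    have xr: "x + r *\<^sub>R e' \<in> U" using r by simp
    show "norm (W (z e (x + r *\<^sub>R e') s) - W (z e (x + 0 *\<^sub>R e') s))
        \<le> L' * norm (z e (x + r *\<^sub>R e') s - z e (x + 0 *\<^sub>R e') s)"
      using z_est(3)[OF x e s x e s xr e s] by simp
    show "norm (W (z e (x + r *\<^sub>R e') s) - W (z e (x + 0 *\<^sub>R e') s)
          - tangent_field_deriv V1 V2 (z e x s) (z e (x + r *\<^sub>R e') s - z e (x + 0 *\<^sub>R e') s))
        \<le> L' * (norm (z e (x + r *\<^sub>R e') s - z e (x + 0 *\<^sub>R e') s))\<^sup>2"
      using z_est(4)[OF x e s x e s xr e s] by simp
  next
    fix s v assume s: "s \<in> {0..T}"
    show "linear (tangent_field_deriv V1 V2 (z e x s))"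
      using z_est(1)[OF x e s x e s x e s] .
    show "norm (tangent_field_deriv V1 V2 (z e x s) v) \<le> L' * norm v"
      using z_est(2)[OF x e s x e s x e s] .
  qed (use x in simp)
  hence ex_K: "Q e' e x (SOME K. Q e' e x K)" if "x \<in> U" "norm e = 1" "norm e' = 1" for x e e'
    using that by (simp add: someI_ex)
  define K where "K = (\<lambda>e' e x. SOME K. Q e' e x K)"
  have K: "norm (K e' e x t) \<le> C \<and> (\<forall>r. x + r *\<^sub>R e' \<in> U \<longrightarrow>
      norm (z e (x + r *\<^sub>R e') t - z e x t - r *\<^sub>R K e' e x t) \<le> C * r\<^sup>2)"
    if "x \<in> U" "norm e = 1" "norm e' = 1" "t \<in> {0..T}" for e' e x t
    using ex_K[OF that(1-3)] that(4) unfolding Q_def K_def by blast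
  \<comment> \<open>The first component of \<open>K\<close> only repeats a first derivative; the
    second component is the second derivative of the flow.\<close>
  show ?thesis
  proof (rule that[of J "\<lambda>e' e x t. snd (K e' e x t)"])
    fix x z t assume xz: "x \<in> U" "z \<in> U" and t: "t \<in> {0..T}"
    have "norm (y z t - y x t) \<le> norm (z - x) * exp (L * t)"
      using xz S by (intro solves_on_diff_le[OF sol sol L t] C2_estimatesD(6)[OF est]) auto
    also have "\<dots> \<le> norm (z - x) * C"
    proof -
      have "exp (L * t) \<le> exp (L * T)" using t L by (auto intro: mult_left_mono)
      hence "exp (L * t) \<le> C" using fb(1) C by linarith
      thus ?thesis by (intro mult_left_mono) auto
    qed
    finally show "norm (y z t - y x t) \<le> C * norm (z - x)" by (simp add: mult.commute)
  next
    fix x z' t and e :: 'a assume xz: "x \<in> U" "z' \<in> U" and t: "t \<in> {0..T}" and e: "norm e = 1"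
    \<comment> \<open>The tangent solutions start from the same vector \<open>e\<close>, hence at
      distance \<open>norm (z' - x)\<close>; Gronwall for the tangent equation does the
      rest.\<close>
    have "norm (J e z' t - J e x t) \<le> norm (z e z' t - z e x t)"
      using norm_snd_le[of "J e z' t - J e x t" "y z' t - y x t"] by (simp add: z_def)
    also have "\<dots> \<le> norm ((z', e) - (x, e)) * exp (L' * t)"
      using xz S e by (intro solves_on_diff_le[OF z_sol z_sol L' t] z_est(3)) auto
    also have "\<dots> = norm (z' - x) * exp (L' * t)" by (simp add: norm_Pair)
    also have "\<dots> \<le> norm (z' - x) * C"
    proof -
      have "exp (L' * t) \<le> exp (L' * T)" using t L' by (auto intro: mult_left_mono)
      hence "exp (L' * t) \<le> C" using fb(4) C by linarith
      thus ?thesis by (intro mult_left_mono) auto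
    qed
    finally show "norm (J e z' t - J e x t) \<le> C * norm (z' - x)" by (simp add: mult.commute)
  next
    fix e :: 'a and x t assume "x \<in> U" "t \<in> {0..T}" "norm e = 1"
    thus "norm (J e x t) \<le> C" using J_le[of x e t] fb C by (auto simp: R_def)
  next
    fix e :: 'a and x t r assume "x \<in> U" "x + r *\<^sub>R e \<in> U" "t \<in> {0..T}" "norm e = 1"
    thus "norm (y (x + r *\<^sub>R e) t - y x t - r *\<^sub>R J e x t) \<le> C * r\<^sup>2"
      using J[of x e t] mult_right_mono[OF C(1), of "r\<^sup>2"] by force
  next
    fix e e' :: 'a and x t assume "x \<in> U" "t \<in> {0..T}" "norm e = 1" "norm e' = 1"
    thus "norm (snd (K e' e x t)) \<le> C"
      using K[of x e e' t] norm_snd_le[of "snd (K e' e x t)" "fst (K e' e x t)"] by auto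
  next
    fix e e' :: 'a and x t r assume *: "x \<in> U" "x + r *\<^sub>R e' \<in> U" "t \<in> {0..T}" "norm e = 1" "norm e' = 1"
    let ?d = "z e (x + r *\<^sub>R e') t - z e x t - r *\<^sub>R K e' e x t"
    have "snd ?d = J e (x + r *\<^sub>R e') t - J e x t - r *\<^sub>R snd (K e' e x t)"
      by (simp add: z_def)
    moreover have "norm (snd ?d) \<le> norm ?d"
      using norm_snd_le[of "snd ?d" "fst ?d"] by (simp only: prod.collapse)
    ultimately show "norm (J e (x + r *\<^sub>R e') t - J e x t - r *\<^sub>R snd (K e' e x t)) \<le> C * r\<^sup>2"
      using K[of x e e' t] * by force
  qed
qed

section \<open>Partial derivatives\<close>

text \<open>\<open>deriv\<close> takes an unspecified value where no derivative exists; here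
  existence and value are asserted together.\<close>

definition has_partial :: "'n \<Rightarrow> (real^'n \<Rightarrow> real) \<Rightarrow> real \<Rightarrow> real^'n \<Rightarrow> bool" where
  "has_partial i g d x \<longleftrightarrow> ((\<lambda>s. g (x + s *\<^sub>R axis i 1)) has_real_derivative d) (at 0)"

section \<open>Mean value estimates from partial derivatives\<close>

lemma has_partial_along_line:
  assumes "has_partial i g d (x + s *\<^sub>R axis i 1)"
  shows "((\<lambda>s. g (x + s *\<^sub>R axis i 1)) has_real_derivative d) (at s)"
  using assms DERIV_shift[of "\<lambda>s. g (x + s *\<^sub>R axis i 1)" d 0 s]
  by (simp add: has_partial_def scaleR_add_left add_ac)

text \<open>The coordinates of \<open>h\<close> are switched on one at a time, with the
  one-dimensional mean value theorem at each switch. Dropping or shrinking coordinates does not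
  increase the Euclidean norm, so the broken path stays in the ball. The numbers \<open>c i\<close>
  are free: 0 gives a Lipschitz bound, \<open>g' i x\<close> gives differentiability.\<close>

lemma partials_box_estimate:
  fixes g :: "real^'n::finite \<Rightarrow> real"
  assumes g: "\<And>z i. z \<in> ball x r \<Longrightarrow> has_partial i g (g' i z) z"
    and c: "\<And>z i. z \<in> ball x r \<Longrightarrow> \<bar>g' i z - c i\<bar> \<le> \<epsilon>"
    and h: "norm h < r"
  shows "\<bar>g (x + h) - g x - (\<Sum>i\<in>UNIV. c i * h $ i)\<bar> \<le> \<epsilon> * (\<Sum>i\<in>UNIV. \<bar>h $ i\<bar>)"
proof -
  define p :: "'n set \<Rightarrow> real^'n" where "p = (\<lambda>A. \<chi> i. if i \<in> A then h $ i else 0)"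
  have "\<bar>g (x + p A) - g x - (\<Sum>i\<in>A. c i * h $ i)\<bar> \<le> \<epsilon> * (\<Sum>i\<in>A. \<bar>h $ i\<bar>)" if "finite A" for A
    using that
  proof induction
    case empty
    have "p {} = 0" by (simp add: p_def vec_eq_iff)
    thus ?case by simp
  next
    case (insert k A)
    define l where "l = (\<lambda>s. x + p A + (s * h $ k) *\<^sub>R axis k 1)"
    have l_in: "l s \<in> ball x r" if "0 \<le> s" "s \<le> 1" for s
    proof -
      have "norm (p A + (s * h $ k) *\<^sub>R axis k 1) \<le> norm h"
        using insert.hyps that
        by (intro norm_le_componentwise_cart) (auto simp: p_def axis_def abs_mult mult_left_le_one_le)
      moreover have "dist (l s) x = norm (p A + (s * h $ k) *\<^sub>R axis k 1)"
        by (simp add: l_def dist_norm add.assoc)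
      ultimately show ?thesis using h unfolding mem_ball dist_commute[of x] by linarith
    qed
    have "\<exists>s>0. s < 1 \<and> g (l 1) - g (l 0) = (1 - 0) * (g' k (l s) * h $ k)"
    proof (rule MVT2)
      fix s :: real assume "0 \<le> s" "s \<le> 1"
      hence p: "has_partial k g (g' k (l s)) (x + p A + (s * h $ k) *\<^sub>R axis k 1)"
        using g[OF l_in] by (simp add: l_def)
      have "((\<lambda>s. s * h $ k) has_real_derivative h $ k) (at s)"
        by (auto intro!: derivative_eq_intros)
      from DERIV_chain2[where g = "\<lambda>s. s * h $ k" and x = s, OF has_partial_along_line[OF p] this]
      show "((\<lambda>s. g (l s)) has_real_derivative g' k (l s) * h $ k) (at s)"
        by (simp add: l_def)
    qed auto
    then obtain s where s: "0 < s" "s < 1" "g (l 1) - g (l 0) = g' k (l s) * h $ k" by auto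
    have "l 1 = x + p (insert k A)" "l 0 = x + p A"
      using insert.hyps by (auto simp: l_def p_def axis_def vec_eq_iff)
    hence "g (x + p (insert k A)) - g x - (\<Sum>i\<in>insert k A. c i * h $ i)
        = (g' k (l s) - c k) * h $ k + (g (x + p A) - g x - (\<Sum>i\<in>A. c i * h $ i))"
      using s(3) insert.hyps by (simp add: algebra_simps)
    also have "\<bar>\<dots>\<bar> \<le> \<bar>g' k (l s) - c k\<bar> * \<bar>h $ k\<bar> + \<epsilon> * (\<Sum>i\<in>A. \<bar>h $ i\<bar>)"
      using insert.IH by (intro order.trans[OF abs_triangle_ineq] add_mono) (auto simp: abs_mult)
    also have "\<dots> \<le> \<epsilon> * \<bar>h $ k\<bar> + \<epsilon> * (\<Sum>i\<in>A. \<bar>h $ i\<bar>)"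
      using s by (intro add_right_mono mult_right_mono c l_in) auto
    finally show ?case using insert.hyps by (simp add: algebra_simps)
  qed
  from this[of UNIV] show ?thesis by (simp add: p_def)
qed

lemma sum_abs_le_norm: "(\<Sum>i\<in>UNIV. \<bar>h $ i\<bar>) \<le> CARD('n) * norm (h :: real^'n::finite)"
  using sum_bounded_above[of UNIV "\<lambda>i. \<bar>h $ i\<bar>" "norm h"] component_le_norm_cart by auto

text \<open>A path along the axes may leave a convex set, while the segment stays inside but is not
  an axis direction. So the box estimate is used in small balls around points of the segment, and
  the local bounds are chained.\<close>

lemma partials_bounded_imp_lipschitz:
  fixes g :: "real^'n::finite \<Rightarrow> real" and B :: real
  assumes S: "open S" "convex S" "x \<in> S" "y \<in> S"
    and g: "\<And>z i. z \<in> S \<Longrightarrow> has_partial i g (g' i z) z"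
    and B: "\<And>z i. z \<in> S \<Longrightarrow> \<bar>g' i z\<bar> \<le> B"
  shows "\<bar>g y - g x\<bar> \<le> CARD('n) * B * norm (y - x)"
proof -
  have B0: "0 \<le> B" using B[OF S(3)] abs_ge_zero order.trans by blast
  define l where "l = (\<lambda>s. x + s *\<^sub>R (y - x))"
  define K where "K = CARD('n) * B * norm (y - x)"
  \<comment> \<open>Bisection: the bound is additive over adjacent intervals and holds for short
    intervals around each point, hence on the whole of \<open>{0..1}\<close>.\<close>
  have "\<bar>g (l 1) - g (l 0)\<bar> \<le> K * (1 - 0)"
  proof (rule Bolzano[where P = "\<lambda>a b. \<bar>g (l b) - g (l a)\<bar> \<le> K * (b - a)"])
    fix a b c assume "\<bar>g (l b) - g (l a)\<bar> \<le> K * (b - a)" "\<bar>g (l c) - g (l b)\<bar> \<le> K * (c - b)"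
    thus "\<bar>g (l c) - g (l a)\<bar> \<le> K * (c - a)" by (simp add: algebra_simps)
  next
    fix s :: real assume "0 \<le> s" "s \<le> 1"
    hence "l s \<in> S"
      using convexD_alt[OF S(2,3,4)] by (auto simp: l_def algebra_simps)
    then obtain r where r: "r > 0" "ball (l s) r \<subseteq> S"
      using S(1) open_contains_ball by blast
    have step: "\<bar>g (l s') - g (l s)\<bar> \<le> K * \<bar>s' - s\<bar>" if "\<bar>s' - s\<bar> * norm (y - x) < r" for s'
    proof -
      define h where "h = (s' - s) *\<^sub>R (y - x)"
      have "\<bar>g (l s + h) - g (l s) - (\<Sum>i\<in>UNIV. 0 * h $ i)\<bar> \<le> B * (\<Sum>i\<in>UNIV. \<bar>h $ i\<bar>)"
        using r(2) g B that by (intro partials_box_estimate[where g' = g' and r = r]) (auto simp: h_def)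
      also have "\<dots> \<le> B * (CARD('n) * norm h)"
        by (intro mult_left_mono sum_abs_le_norm B0)
      also have "\<dots> = K * \<bar>s' - s\<bar>" by (simp add: K_def h_def)
      finally show ?thesis by (simp add: h_def l_def algebra_simps)
    qed
    define d where "d = r / (norm (y - x) + 1)"
    have d: "d > 0" using r by (auto simp: d_def add_nonneg_pos)
    have d': "\<bar>s'\<bar> * norm (y - x) < r" if "\<bar>s'\<bar> < d" for s'
    proof -
      have "\<bar>s'\<bar> * norm (y - x) \<le> \<bar>s'\<bar> * (norm (y - x) + 1)" by (simp add: mult_left_mono)
      also have "\<dots> < d * (norm (y - x) + 1)"
        using that by (intro mult_strict_right_mono) (auto simp: add_nonneg_pos)
      also have "\<dots> = r" using norm_ge_zero[of "y - x"] by (simp add: d_def add_nonneg_eq_0_iff)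
      finally show ?thesis .
    qed
    have "\<bar>g (l b) - g (l a)\<bar> \<le> K * (b - a)" if "a \<le> s" "s \<le> b" "b - a < d" for a b
    proof -
      have "\<bar>a - s\<bar> < d" "\<bar>b - s\<bar> < d" using that by auto
      thus ?thesis
        using step[OF d', of a] step[OF d', of b] that by (simp add: algebra_simps)
    qed
    thus "\<exists>d>0. \<forall>a b. a \<le> s \<and> s \<le> b \<and> b - a < d \<longrightarrow> \<bar>g (l b) - g (l a)\<bar> \<le> K * (b - a)"
      using d by blast
  qed auto
  thus ?thesis by (simp add: l_def K_def)
qed

lemma has_partial_linear: "has_partial i (\<lambda>z. \<Sum>j\<in>UNIV. c j * z $ j) (c i) (z :: real^'n::finite)"
proof -
  have "(\<Sum>j\<in>UNIV. c j * (z + s *\<^sub>R axis i 1) $ j) = (\<Sum>j\<in>UNIV. c j * z $ j) + s * c i" for s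
    by (simp add: distrib_left sum.distrib axis_def if_distrib[of "\<lambda>u. _ * u"] mult.commute cong: if_cong)
  thus ?thesis unfolding has_partial_def by (auto intro!: derivative_eq_intros)
qed

lemma has_partial_diff:
  "has_partial i f d x \<Longrightarrow> has_partial i g e x \<Longrightarrow> has_partial i (\<lambda>z. f z - g z) (d - e) x"
  unfolding has_partial_def by (rule DERIV_diff)

text \<open>The Lipschitz lemma is applied to \<open>g\<close> minus its linear part at
  \<open>a\<close>, whose partials are small near \<open>a\<close>. The ball around \<open>a\<close>
  gets the radius \<open>2 * norm (b - a)\<close> so that, being open, it contains \<open>b\<close>;
  this is the factor 2 of the bound.\<close>

lemma partials_lipschitz_imp_taylor:
  fixes g :: "real^'n::finite \<Rightarrow> real" and K :: real
  assumes S: "open S" "convex S" "a \<in> S" "b \<in> S"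
    and g: "\<And>z i. z \<in> S \<Longrightarrow> has_partial i g (g' i z) z"
    and K: "\<And>z i. z \<in> S \<Longrightarrow> \<bar>g' i z - g' i a\<bar> \<le> K * norm (z - a)"
    and K0: "0 \<le> K"
  shows "\<bar>g b - g a - (\<Sum>i\<in>UNIV. g' i a * (b - a) $ i)\<bar> \<le> 2 * real CARD('n) * K * (norm (b - a))\<^sup>2"
proof (cases "a = b")
  case False
  define S' where "S' = S \<inter> ball a (2 * norm (b - a))"
  have "\<bar>(g b - (\<Sum>i\<in>UNIV. g' i a * b $ i)) - (g a - (\<Sum>i\<in>UNIV. g' i a * a $ i))\<bar>
      \<le> CARD('n) * (K * (2 * norm (b - a))) * norm (b - a)"
  proof (rule partials_bounded_imp_lipschitz[where S = S' and g' = "\<lambda>i z. g' i z - g' i a"])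
    show "open S'" "convex S'" using S by (auto simp: S'_def open_Int convex_Int)
    show "a \<in> S'" "b \<in> S'" using S False by (auto simp: S'_def dist_norm norm_minus_commute)
    fix z i assume z: "z \<in> S'"
    thus "has_partial i (\<lambda>z. g z - (\<Sum>i\<in>UNIV. g' i a * z $ i)) (g' i z - g' i a) z"
      using g by (intro has_partial_diff has_partial_linear[where c = "\<lambda>i. g' i a"]) (auto simp: S'_def)
    have "\<bar>g' i z - g' i a\<bar> \<le> K * norm (z - a)" using z K by (auto simp: S'_def)
    also have "\<dots> \<le> K * (2 * norm (b - a))"
      using z K0 by (intro mult_left_mono) (auto simp: S'_def dist_norm norm_minus_commute)
    finally show "\<bar>g' i z - g' i a\<bar> \<le> K * (2 * norm (b - a))" .
  qed
  thus ?thesis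
    by (simp add: sum_subtractf right_diff_distrib power2_eq_square algebra_simps)
qed auto

text \<open>The box estimate with \<open>c i = g' i x\<close>. The chain rule along the flow needs
  the total derivative, since the flow does not move along coordinate axes.\<close>

lemma partials_continuous_imp_has_derivative:
  fixes g :: "real^'n::finite \<Rightarrow> real"
  assumes S: "open S" "x \<in> S"
    and g: "\<And>z i. z \<in> S \<Longrightarrow> has_partial i g (g' i z) z"
    and cont: "\<And>i. continuous_on S (g' i)"
  shows "(g has_derivative (\<lambda>h. \<Sum>i\<in>UNIV. g' i x * h $ i)) (at x)"
  unfolding has_derivative_within_alt
proof (intro conjI allI impI)
  show "bounded_linear (\<lambda>h :: real^'n. \<Sum>i\<in>UNIV. g' i x * h $ i)"
    by (intro bounded_linear_sum bounded_linear_const_mult bounded_linear_vec_nth)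
  fix e :: real assume e: "e > 0"
  define \<epsilon> where "\<epsilon> = e / CARD('n)"
  have \<epsilon>: "\<epsilon> > 0" using e by (simp add: \<epsilon>_def)
  have "\<forall>\<^sub>F z in nhds x. z \<in> S \<and> (\<forall>i. \<bar>g' i z - g' i x\<bar> < \<epsilon>)"
  proof (intro eventually_conj eventually_all_finite)
    show "\<forall>\<^sub>F z in nhds x. z \<in> S" using S eventually_nhds by blast
    fix i
    have "isCont (g' i) x" using cont S continuous_on_eq_continuous_at by blast
    hence "(g' i \<longlongrightarrow> g' i x) (nhds x)"
      by (simp add: continuous_at tendsto_at_iff_tendsto_nhds)
    from tendstoD[OF this \<epsilon>] show "\<forall>\<^sub>F z in nhds x. \<bar>g' i z - g' i x\<bar> < \<epsilon>"
      by (simp add: dist_real_def)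
  qed
  then obtain r where r: "r > 0" "\<And>z. dist z x < r \<Longrightarrow> z \<in> S \<and> (\<forall>i. \<bar>g' i z - g' i x\<bar> < \<epsilon>)"
    unfolding eventually_nhds_metric by blast
  show "\<exists>d>0. \<forall>y\<in>UNIV. norm (y - x) < d \<longrightarrow>
      norm (g y - g x - (\<Sum>i\<in>UNIV. g' i x * (y - x) $ i)) \<le> e * norm (y - x)"
  proof (intro exI[of _ r] conjI r(1) ballI impI)
    fix y assume y: "norm (y - x) < r"
    have "\<bar>g (x + (y - x)) - g x - (\<Sum>i\<in>UNIV. g' i x * (y - x) $ i)\<bar> \<le> \<epsilon> * (\<Sum>i\<in>UNIV. \<bar>(y - x) $ i\<bar>)"
      using r y g by (intro partials_box_estimate[where r = r and g' = g']) (auto simp: dist_commute less_imp_le)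
    also have "\<dots> \<le> \<epsilon> * (CARD('n) * norm (y - x))"
      using \<epsilon> by (intro mult_left_mono sum_abs_le_norm) auto
    finally show "norm (g y - g x - (\<Sum>i\<in>UNIV. g' i x * (y - x) $ i)) \<le> e * norm (y - x)"
      by (simp add: \<epsilon>_def)
  qed
qed

section \<open>Symmetry of second partial derivatives\<close>

lemma mixed_difference:
  assumes g1: "\<And>x. has_partial i g (g1 x) x" and g2: "\<And>x. has_partial j g1 (g2 x) x" and h: "h > 0"
  obtains \<sigma> \<tau> where "0 < \<sigma>" "\<sigma> < h" "0 < \<tau>" "\<tau> < h"
    "g (x + h *\<^sub>R axis i 1 + h *\<^sub>R axis j 1) - g (x + h *\<^sub>R axis i 1) - g (x + h *\<^sub>R axis j 1) + g x
      = h\<^sup>2 * g2 (x + \<sigma> *\<^sub>R axis i 1 + \<tau> *\<^sub>R axis j 1)"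
proof -
  define \<phi> where "\<phi> = (\<lambda>s. g (x + h *\<^sub>R axis j 1 + s *\<^sub>R axis i 1) - g (x + s *\<^sub>R axis i 1))"
  have "\<exists>s>0. s < h \<and> \<phi> h - \<phi> 0
      = (h - 0) * (g1 (x + h *\<^sub>R axis j 1 + s *\<^sub>R axis i 1) - g1 (x + s *\<^sub>R axis i 1))"
    using h unfolding \<phi>_def by (intro MVT2 DERIV_diff has_partial_along_line g1) auto
  then obtain \<sigma> where \<sigma>: "0 < \<sigma>" "\<sigma> < h" "\<phi> h - \<phi> 0
      = h * (g1 (x + h *\<^sub>R axis j 1 + \<sigma> *\<^sub>R axis i 1) - g1 (x + \<sigma> *\<^sub>R axis i 1))" by auto
  have "\<exists>t>0. t < h \<and> g1 (x + \<sigma> *\<^sub>R axis i 1 + h *\<^sub>R axis j 1) - g1 (x + \<sigma> *\<^sub>R axis i 1 + 0 *\<^sub>R axis j 1)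
      = (h - 0) * g2 (x + \<sigma> *\<^sub>R axis i 1 + t *\<^sub>R axis j 1)"
    using h by (intro MVT2 has_partial_along_line g2) auto
  then obtain \<tau> where "0 < \<tau>" "\<tau> < h" "g1 (x + \<sigma> *\<^sub>R axis i 1 + h *\<^sub>R axis j 1) - g1 (x + \<sigma> *\<^sub>R axis i 1)
      = h * g2 (x + \<sigma> *\<^sub>R axis i 1 + \<tau> *\<^sub>R axis j 1)" by auto
  with \<sigma> show ?thesis
    by (intro that[of \<sigma> \<tau>]) (auto simp: \<phi>_def power2_eq_square add_ac)
qed

text \<open>The second difference over a square with side \<open>h n\<close> is symmetric in the two
  directions, and \<open>mixed_difference\<close> expresses it through either order of
  differentiation at points that tend to \<open>x\<close>. Continuity concludes.\<close>

lemma mixed_partials_commute: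
  fixes g :: "real^'n::finite \<Rightarrow> real"
  assumes g1: "\<And>x i. has_partial i g (g1 i x) x"
    and g2: "\<And>x i j. has_partial j (g1 i) (g2 j i x) x"
    and cont: "\<And>i j. continuous_on UNIV (g2 i j)"
  shows "g2 i j x = g2 j i x"
proof -
  define h where "h = (\<lambda>n. 1 / real (Suc n))"
  have h: "h n > 0" for n by (simp add: h_def)
  have h0: "h \<longlonglongrightarrow> 0" unfolding h_def by (rule LIMSEQ_Suc[OF lim_const_over_n])
  have "\<exists>a b. norm (a - x) \<le> 2 * h n \<and> norm (b - x) \<le> 2 * h n \<and> g2 j i a = g2 i j b" for n
  proof -
    obtain \<sigma> \<tau> where 1: "0 < \<sigma>" "\<sigma> < h n" "0 < \<tau>" "\<tau> < h n"
      "g (x + h n *\<^sub>R axis i 1 + h n *\<^sub>R axis j 1) - g (x + h n *\<^sub>R axis i 1) - g (x + h n *\<^sub>R axis j 1) + g x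
      = (h n)\<^sup>2 * g2 j i (x + \<sigma> *\<^sub>R axis i 1 + \<tau> *\<^sub>R axis j 1)"
      by (rule mixed_difference[OF g1 g2 h])
    obtain \<sigma>' \<tau>' where 2: "0 < \<sigma>'" "\<sigma>' < h n" "0 < \<tau>'" "\<tau>' < h n"
      "g (x + h n *\<^sub>R axis j 1 + h n *\<^sub>R axis i 1) - g (x + h n *\<^sub>R axis j 1) - g (x + h n *\<^sub>R axis i 1) + g x
      = (h n)\<^sup>2 * g2 i j (x + \<sigma>' *\<^sub>R axis j 1 + \<tau>' *\<^sub>R axis i 1)"
      by (rule mixed_difference[OF g1 g2 h])
    have "(h n)\<^sup>2 * g2 j i (x + \<sigma> *\<^sub>R axis i 1 + \<tau> *\<^sub>R axis j 1)
        = (h n)\<^sup>2 * g2 i j (x + \<sigma>' *\<^sub>R axis j 1 + \<tau>' *\<^sub>R axis i 1)"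
      unfolding 1(5)[symmetric] 2(5)[symmetric] by (simp add: add_ac)
    hence "g2 j i (x + \<sigma> *\<^sub>R axis i 1 + \<tau> *\<^sub>R axis j 1) = g2 i j (x + \<sigma>' *\<^sub>R axis j 1 + \<tau>' *\<^sub>R axis i 1)"
      using h[of n] by simp
    moreover have "norm (x + s *\<^sub>R axis k 1 + t *\<^sub>R axis l 1 - x) \<le> 2 * h n"
      if "0 < s" "s < h n" "0 < t" "t < h n" for s t k l
      using norm_triangle_ineq[of "s *\<^sub>R (axis k 1 :: real^'n)" "t *\<^sub>R axis l 1"] that
      by (simp add: add.assoc)
    ultimately show ?thesis using 1(1-4) 2(1-4) by blast
  qed
  then obtain a b where ab: "\<And>n. norm (a n - x) \<le> 2 * h n" "\<And>n. norm (b n - x) \<le> 2 * h n"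
    "\<And>n. g2 j i (a n) = g2 i j (b n)" by metis
  have 0: "(\<lambda>n. 2 * h n) \<longlonglongrightarrow> 0" by (rule tendsto_mult_right_zero[OF h0])
  have lims: "a \<longlonglongrightarrow> x" "b \<longlonglongrightarrow> x"
    using Lim_null_comparison[OF always_eventually 0, of "\<lambda>n. a n - x"]
      Lim_null_comparison[OF always_eventually 0, of "\<lambda>n. b n - x"] ab(1,2)
    by (auto intro: LIM_zero_cancel)
  have "(\<lambda>n. g2 j i (a n)) \<longlonglongrightarrow> g2 j i x" "(\<lambda>n. g2 i j (b n)) \<longlonglongrightarrow> g2 i j x"
    by (rule continuous_on_tendsto_compose[OF cont]; simp add: lims)+
  thus ?thesis unfolding ab(3) using LIMSEQ_unique by blast
qed

section \<open>Multi-indices and lists of directions\<close>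

lemma has_partial_imp_partials: "has_partial i (partials is g) d x \<Longrightarrow> partials (i # is) g x = d"
  by (simp add: has_partial_def DERIV_imp_deriv)

lemma has_partials_imp_has_partial:
  "has_partials (i # is) g x \<Longrightarrow> has_partial i (partials is g) (partials (i # is) g x) x"
  by (simp add: has_partial_def DERIV_deriv_iff_real_differentiable)

lemma sum_count_list: "sum (count_list is) (UNIV :: 'n::finite set) = length is"
  by (rule sum_count_set) auto

text \<open>\<open>count_list is\<close> is the multi-index that remains of \<open>is\<close> when
  the order is forgotten, so facts about multi-indices can be used for every list.\<close>

lemma has_multi_deriv_imp_partials:
  assumes "\<exists>d. has_multi_deriv (count_list is) g d x"
  shows "has_partials is g x" "partials is g x = multi_deriv (count_list is) g x"
proof -
  obtain d where d: "has_multi_deriv (count_list is) g d x" using assms ..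
  hence "has_partials is g x \<and> partials is g x = d"
    unfolding has_multi_deriv_def by blast
  with has_multi_deriv_imp_multi_deriv[OF d]
  show "has_partials is g x" "partials is g x = multi_deriv (count_list is) g x" by auto
qed

lemma C_b_partials:
  fixes g :: "real^'n::finite \<Rightarrow> real"
  assumes "g \<in> C_b k" "length is \<le> k"
  shows "has_partials is g x" "continuous_on UNIV (partials is g)" "bounded (range (partials is g))"
proof -
  have *: "(\<forall>x. \<exists>d. has_multi_deriv (count_list is) g d x) \<and>
     continuous_on UNIV (multi_deriv (count_list is) g) \<and> bounded (range (multi_deriv (count_list is) g))"
    using assms by (auto simp: C_b_def sum_count_list)
  moreover have "partials is g = multi_deriv (count_list is) g"
    using * has_multi_deriv_imp_partials(2) by blast
  ultimately show "continuous_on UNIV (partials is g)" "bounded (range (partials is g))"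
    by auto
  show "has_partials is g x"
    using * by (intro has_multi_deriv_imp_partials(1)) blast
qed

lemma length_le_2_cases:
  assumes "length is \<le> 2"
  shows "is = [] \<or> (\<exists>i. is = [i]) \<or> (\<exists>i j. is = [i, j])"
  using assms by (cases "is" rule: remdups_adj.cases) (auto simp: length_Suc_conv)

lemma C_b_2I:
  fixes g :: "real^'n::finite \<Rightarrow> real"
  assumes g1: "\<And>x i. has_partial i g (partials [i] g x) x"
    and g2: "\<And>x i j. has_partial i (partials [j] g) (partials [i, j] g x) x"
    and cont: "\<And>is. length is \<le> 2 \<Longrightarrow> continuous_on UNIV (partials is g)"
    and bdd: "\<And>is. length is \<le> 2 \<Longrightarrow> bounded (range (partials is g))"
  shows "g \<in> C_b 2"
  unfolding C_b_def
proof (intro CollectI allI impI)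
  fix \<alpha> :: "'n \<Rightarrow> nat" assume \<alpha>: "sum \<alpha> UNIV \<le> 2"
  have diff: "(\<lambda>s. g (x + s *\<^sub>R axis i 1)) differentiable (at 0)"
    "(\<lambda>s. partials [j] g (x + s *\<^sub>R axis i 1)) differentiable (at 0)" for x i j
    using g1[of i x] g2[of i j x] unfolding has_partial_def real_differentiable_def by blast+
  obtain A where A: "\<And>i. count A i = \<alpha> i"
    using count_Abs_multiset[of \<alpha>] by (metis finite)
  obtain "is" where "mset is = A" using ex_mset by blast
  hence count: "count_list is i = \<alpha> i" for i using A by (metis count_mset)
  hence "count_list is = \<alpha>" by auto
  hence len_is: "length is \<le> 2" using \<alpha> sum_count_list by metis
  have "has_multi_deriv \<alpha> g (partials is g x) x" for x
    unfolding has_multi_deriv_def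
  proof (intro allI impI)
    fix js assume "\<forall>i. count_list js i = \<alpha> i"
    hence "mset js = mset is" using count by (intro multiset_eqI) (simp add: count_mset)
    moreover from this have len_js: "length js \<le> 2" using len_is by (metis size_mset)
    \<comment> \<open>Two arrangements of at most two directions are equal or differ by a swap, so
      the symmetry of second partials settles the independence of the order.\<close>
    ultimately have "js = is \<or> (\<exists>i j. js = [i, j] \<and> is = [j, i])"
      using length_le_2_cases[OF len_is] length_le_2_cases[OF len_js] by (auto simp: add_eq_conv_ex)
    moreover have "partials [i, j] g x = partials [j, i] g x" for i j
      using mixed_partials_commute[OF g1 g2 cont] by simp
    moreover have "has_partials js g x"
      using length_le_2_cases[OF len_js] diff by auto
    ultimately show "has_partials js g x \<and> partials js g x = partials is g x" by metis
  qed
  moreover from this have "multi_deriv \<alpha> g = partials is g"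
    using has_multi_deriv_imp_multi_deriv by blast
  ultimately show "(\<forall>x. \<exists>d. has_multi_deriv \<alpha> g d x) \<and> continuous_on UNIV (multi_deriv \<alpha> g) \<and>
      bounded (range (multi_deriv \<alpha> g))"
    using cont[OF len_is] bdd[OF len_is] by metis
qed

section \<open>Uniform Taylor estimates for the vector field\<close>

lemma norm_le_card_mult:
  fixes x :: "real^'n::finite" and c :: real
  assumes "\<And>i. \<bar>x $ i\<bar> \<le> c"
  shows "norm x \<le> CARD('n) * c"
  using order.trans[OF norm_le_l1_cart[of x] sum_bounded_above[of UNIV "\<lambda>i. \<bar>x $ i\<bar>" c]] assms by auto

lemma abs_sum_mult_le:
  fixes v :: "real^'n::finite" and c :: real
  assumes "\<And>i. \<bar>a i\<bar> \<le> c" "0 \<le> c"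
  shows "\<bar>\<Sum>i\<in>UNIV. a i * v $ i\<bar> \<le> CARD('n) * c * norm v"
proof -
  have "\<bar>\<Sum>i\<in>UNIV. a i * v $ i\<bar> \<le> (\<Sum>i\<in>UNIV. c * \<bar>v $ i\<bar>)"
    using assms by (intro order.trans[OF sum_abs] sum_mono) (auto simp: abs_mult mult_right_mono)
  also have "\<dots> \<le> c * (CARD('n) * norm v)"
    using assms by (auto simp: sum_distrib_left[symmetric] intro!: mult_left_mono sum_abs_le_norm)
  finally show ?thesis by (simp add: mult_ac)
qed

text \<open>The constant is that of the worst estimate, the Taylor error of \<open>V1\<close>: a
  factor \<open>N\<close> from the norm of a vector, \<open>N\<close> from the sum over
  \<open>k\<close>, \<open>2 * N\<close> from the Taylor lemma and \<open>N * B\<close> as Lipschitz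
  constant of the second partials. The fact \<open>mono\<close> raises the other constants to it,
  using that \<open>N\<close> is at least 1.\<close>

lemma partials_imp_C2_estimates:
  fixes V :: "real^'n::finite \<Rightarrow> real^'n" and B :: real
  assumes S: "open S" "convex S" and B0: "0 \<le> B"
    and V1: "\<And>x i k. x \<in> S \<Longrightarrow> has_partial k (\<lambda>y. V y $ i) (V1 i k x) x"
    and V2: "\<And>x i k l. x \<in> S \<Longrightarrow> has_partial l (V1 i k) (V2 i k l x) x"
    and V3: "\<And>x i k l m. x \<in> S \<Longrightarrow> has_partial m (V2 i k l) (V3 i k l m x) x"
    and B: "\<And>x i k. x \<in> S \<Longrightarrow> \<bar>V1 i k x\<bar> \<le> B" "\<And>x i k l. x \<in> S \<Longrightarrow> \<bar>V2 i k l x\<bar> \<le> B"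
      "\<And>x i k l m. x \<in> S \<Longrightarrow> \<bar>V3 i k l m x\<bar> \<le> B"
  shows "C2_estimates S (2 * real CARD('n) ^ 4 * B) V (\<lambda>a v. \<chi> i. \<Sum>k\<in>UNIV. V1 i k a * v $ k)
    (\<lambda>a h v. \<chi> i. \<Sum>k\<in>UNIV. (\<Sum>l\<in>UNIV. V2 i k l a * h $ l) * v $ k)"
proof -
  define N where "N = real CARD('n)"
  have N: "1 \<le> N" unfolding N_def using zero_less_card_finite[where 'a = 'n] by linarith
  have mono: "c * N ^ k * B * X \<le> 2 * N ^ 4 * B * X" if "k \<le> 4" "0 \<le> X" "0 \<le> c" "c \<le> 2" for k c X
    using that N B0 by (intro mult_right_mono mult_mono power_increasing) auto
  note lip = partials_bounded_imp_lipschitz[OF S, folded N_def]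
  note taylor = partials_lipschitz_imp_taylor[OF S, folded N_def]
  note nrm = norm_le_card_mult[where 'n = 'n, folded N_def]
  note sm = abs_sum_mult_le[where 'n = 'n, folded N_def]
  have V1_lip: "\<bar>V1 i k b - V1 i k a\<bar> \<le> N * B * norm (b - a)" if "a \<in> S" "b \<in> S" for a b i k
    by (rule lip[OF that V2 B(2)])
  have V2_lip: "\<bar>V2 i k l b - V2 i k l a\<bar> \<le> N * B * norm (b - a)" if "a \<in> S" "b \<in> S" for a b i k l
    by (rule lip[OF that V3 B(3)])
  have V1_taylor: "\<bar>V1 i k b - V1 i k a - (\<Sum>l\<in>UNIV. V2 i k l a * (b - a) $ l)\<bar>
      \<le> 2 * N * (N * B) * (norm (b - a))\<^sup>2" if "a \<in> S" "b \<in> S" for a b i k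
    using that N B0 by (intro taylor V2 V2_lip) auto
  show ?thesis
    unfolding C2_estimates_def N_def[symmetric]
  proof (intro conjI ballI allI)
    show "0 \<le> 2 * N ^ 4 * B" using B0 N by simp
    fix a assume a: "a \<in> S"
    show "linear (\<lambda>v. \<chi> i. \<Sum>k\<in>UNIV. V1 i k a * v $ k)"
      by (rule linearI) (simp_all add: vec_eq_iff algebra_simps sum.distrib sum_distrib_left)
    show "linear (\<lambda>h. \<chi> i. \<Sum>k\<in>UNIV. (\<Sum>l\<in>UNIV. V2 i k l a * h $ l) * v $ k)" for v :: "real^'n"
      by (rule linearI) (simp_all add: vec_eq_iff algebra_simps sum.distrib sum_distrib_left)
    fix h v :: "real^'n"
    have "norm (\<chi> i. \<Sum>k\<in>UNIV. V1 i k a * v $ k) \<le> N * (N * B * norm v)"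
      using B0 by (intro nrm) (auto intro!: sm B a)
    also have "\<dots> \<le> 2 * N ^ 4 * B * norm v"
      using mono[of 2 "norm v" 1] by (simp add: power2_eq_square mult_ac)
    finally show "norm (\<chi> i. \<Sum>k\<in>UNIV. V1 i k a * v $ k) \<le> 2 * N ^ 4 * B * norm v" .
    have "norm (\<chi> i. \<Sum>k\<in>UNIV. (\<Sum>l\<in>UNIV. V2 i k l a * h $ l) * v $ k) \<le> N * (N * (N * B * norm h) * norm v)"
      using B0 N by (intro nrm) (auto intro!: sm B a)
    also have "\<dots> \<le> 2 * N ^ 4 * B * norm h * norm v"
      using mono[of 3 "norm h * norm v" 1] by (simp add: power3_eq_cube mult_ac)
    finally show "norm (\<chi> i. \<Sum>k\<in>UNIV. (\<Sum>l\<in>UNIV. V2 i k l a * h $ l) * v $ k)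
      \<le> 2 * N ^ 4 * B * norm h * norm v" .
    fix b assume b: "b \<in> S"
    have "norm (V b - V a) \<le> N * (N * B * norm (b - a))"
      by (intro nrm) (auto intro!: lip[OF a b V1 B(1)])
    also have "\<dots> \<le> 2 * N ^ 4 * B * norm (b - a)"
      using mono[of 2 "norm (b - a)" 1] by (simp add: power2_eq_square mult_ac)
    finally show "norm (V b - V a) \<le> 2 * N ^ 4 * B * norm (b - a)" .
    have "norm (V b - V a - (\<chi> i. \<Sum>k\<in>UNIV. V1 i k a * (b - a) $ k))
        \<le> N * (2 * N * (N * B) * (norm (b - a))\<^sup>2)"
    proof (rule nrm)
      fix i
      have "\<bar>V b $ i - V a $ i - (\<Sum>k\<in>UNIV. V1 i k a * (b - a) $ k)\<bar> \<le> 2 * N * (N * B) * (norm (b - a))\<^sup>2"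
        using a b B0 N by (intro taylor V1 V1_lip) auto
      thus "\<bar>(V b - V a - (\<chi> i. \<Sum>k\<in>UNIV. V1 i k a * (b - a) $ k)) $ i\<bar>
        \<le> 2 * N * (N * B) * (norm (b - a))\<^sup>2" by simp
    qed
    also have "\<dots> \<le> 2 * N ^ 4 * B * (norm (b - a))\<^sup>2"
      using mono[of 3 "(norm (b - a))\<^sup>2" 2] by (simp add: power3_eq_cube mult_ac)
    finally show "norm (V b - V a - (\<chi> i. \<Sum>k\<in>UNIV. V1 i k a * (b - a) $ k))
        \<le> 2 * N ^ 4 * B * (norm (b - a))\<^sup>2" .
    have "norm ((\<chi> i. \<Sum>k\<in>UNIV. V1 i k b * v $ k) - (\<chi> i. \<Sum>k\<in>UNIV. V1 i k a * v $ k))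
        \<le> N * (N * (N * B * norm (b - a)) * norm v)"
    proof (rule nrm)
      fix i
      have "\<bar>\<Sum>k\<in>UNIV. (V1 i k b - V1 i k a) * v $ k\<bar> \<le> N * (N * B * norm (b - a)) * norm v"
        using B0 N by (intro sm V1_lip a b) auto
      thus "\<bar>((\<chi> i. \<Sum>k\<in>UNIV. V1 i k b * v $ k) - (\<chi> i. \<Sum>k\<in>UNIV. V1 i k a * v $ k)) $ i\<bar>
          \<le> N * (N * B * norm (b - a)) * norm v"
        by (simp add: sum_subtractf left_diff_distrib)
    qed
    also have "\<dots> \<le> 2 * N ^ 4 * B * norm (b - a) * norm v"
      using mono[of 3 "norm (b - a) * norm v" 1] by (simp add: power3_eq_cube mult_ac)
    finally show "norm ((\<chi> i. \<Sum>k\<in>UNIV. V1 i k b * v $ k) - (\<chi> i. \<Sum>k\<in>UNIV. V1 i k a * v $ k))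
        \<le> 2 * N ^ 4 * B * norm (b - a) * norm v" .
    have "norm ((\<chi> i. \<Sum>k\<in>UNIV. V1 i k b * v $ k) - (\<chi> i. \<Sum>k\<in>UNIV. V1 i k a * v $ k)
          - (\<chi> i. \<Sum>k\<in>UNIV. (\<Sum>l\<in>UNIV. V2 i k l a * (b - a) $ l) * v $ k))
        \<le> N * (N * (2 * N * (N * B) * (norm (b - a))\<^sup>2) * norm v)"
    proof (rule nrm)
      fix i
      have "\<bar>\<Sum>k\<in>UNIV. (V1 i k b - V1 i k a - (\<Sum>l\<in>UNIV. V2 i k l a * (b - a) $ l)) * v $ k\<bar>
          \<le> N * (2 * N * (N * B) * (norm (b - a))\<^sup>2) * norm v"
        using B0 N by (intro sm V1_taylor a b) auto
      thus "\<bar>((\<chi> i. \<Sum>k\<in>UNIV. V1 i k b * v $ k) - (\<chi> i. \<Sum>k\<in>UNIV. V1 i k a * v $ k)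
          - (\<chi> i. \<Sum>k\<in>UNIV. (\<Sum>l\<in>UNIV. V2 i k l a * (b - a) $ l) * v $ k)) $ i\<bar>
        \<le> N * (2 * N * (N * B) * (norm (b - a))\<^sup>2) * norm v"
        by (simp only: vector_minus_component vec_lambda_beta sum_subtractf left_diff_distrib)
    qed
    also have "\<dots> = 2 * N ^ 4 * B * (norm (b - a))\<^sup>2 * norm v"
      by (simp add: power4_eq_xxxx mult_ac)
    finally show "norm ((\<chi> i. \<Sum>k\<in>UNIV. V1 i k b * v $ k) - (\<chi> i. \<Sum>k\<in>UNIV. V1 i k a * v $ k)
          - (\<chi> i. \<Sum>k\<in>UNIV. (\<Sum>l\<in>UNIV. V2 i k l a * (b - a) $ l) * v $ k))
        \<le> 2 * N ^ 4 * B * (norm (b - a))\<^sup>2 * norm v" .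
  qed
qed

lemma deriv_norm_bound:
  fixes V :: "real^'n::finite \<Rightarrow> real^'n"
  assumes "deriv_norm j M V < \<infinity>" "sum \<alpha> UNIV = j" "x \<in> M"
  shows "\<bar>multi_deriv \<alpha> (\<lambda>y. V y $ i) x\<bar> \<le> enn2real (deriv_norm j M V)"
proof -
  \<comment> \<open>Finiteness of the set of multi-indices matters: a sum over an infinite set would
    be 0 and bound none of its terms.\<close>
  have "\<alpha>' k \<le> j" if "sum \<alpha>' UNIV = j" for \<alpha>' :: "'n \<Rightarrow> nat" and k
    using member_le_sum[of k UNIV \<alpha>'] that by auto
  hence "{\<alpha>' :: 'n \<Rightarrow> nat. sum \<alpha>' UNIV = j} \<subseteq> PiE UNIV (\<lambda>_. {..j})" by auto
  hence fin: "finite {\<alpha>' :: 'n \<Rightarrow> nat. sum \<alpha>' UNIV = j}"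
    by (rule finite_subset) (intro finite_PiE; simp)
  define b where "b = (\<lambda>i \<alpha>. SUP x\<in>M. ennreal \<bar>multi_deriv \<alpha> (\<lambda>y. V y $ i) x\<bar>)"
  have "ennreal \<bar>multi_deriv \<alpha> (\<lambda>y. V y $ i) x\<bar> \<le> b i \<alpha>"
    unfolding b_def by (rule SUP_upper[OF assms(3)])
  also have "b i \<alpha> \<le> (\<Sum>\<alpha> | sum \<alpha> UNIV = j. b i \<alpha>)"
    using assms(2) fin by (intro member_le_sum) auto
  also have "\<dots> \<le> (\<Sum>i\<in>UNIV. \<Sum>\<alpha> | sum \<alpha> UNIV = j. b i \<alpha>)"
    by (intro member_le_sum) auto
  also have "\<dots> = deriv_norm j M V"
    by (simp add: deriv_norm_def b_def)
  finally have "enn2real (ennreal \<bar>multi_deriv \<alpha> (\<lambda>y. V y $ i) x\<bar>) \<le> enn2real (deriv_norm j M V)"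
    using assms(1) by (intro enn2real_mono) auto
  thus ?thesis by simp
qed

text \<open>Every list of one to three directions names a multi-index of that order, so the suprema
  over \<open>M\<close> bound all iterated partials by one \<open>B\<close>. The newest direction
  stands at the head of a list, which makes \<open>partials [l, k]\<close> the
  \<open>V2 i k l\<close> of the previous estimates.\<close>

lemma derivs_imp_C2_estimates:
  fixes V :: "real^'n::finite \<Rightarrow> real^'n"
  assumes S: "open S" "convex S" "S \<subseteq> M"
    and V: "\<And>j. j \<in> {1, 2, 3} \<Longrightarrow> derivs_exist_on j M V \<and> deriv_norm j M V < \<infinity>"
  obtains L V1 V2 where "C2_estimates S L V V1 V2"
proof -
  define B where "B = Max ((\<lambda>j. enn2real (deriv_norm j M V)) ` {1, 2, 3})"
  have *: "has_partials is (\<lambda>y. V y $ i) x \<and> \<bar>partials is (\<lambda>y. V y $ i) x\<bar> \<le> B"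
    if "length is \<in> {1, 2, 3}" "x \<in> M" for "is" i x
  proof -
    have "\<exists>d. has_multi_deriv (count_list is) (\<lambda>y. V y $ i) d x"
      using V[OF that(1)] that(2) by (auto simp: derivs_exist_on_def sum_count_list)
    note this = has_multi_deriv_imp_partials[OF this]
    moreover have "\<bar>multi_deriv (count_list is) (\<lambda>y. V y $ i) x\<bar> \<le> enn2real (deriv_norm (length is) M V)"
      using V[OF that(1)] that(2) by (intro deriv_norm_bound) (auto simp: sum_count_list)
    moreover have "\<dots> \<le> B" unfolding B_def using that(1) by (intro Max_ge) auto
    ultimately show ?thesis by auto
  qed
  have "0 \<le> enn2real (deriv_norm 1 M V)" by simp
  also have "\<dots> \<le> B" unfolding B_def by (intro Max_ge) auto
  finally have "0 \<le> B" .
  show ?thesis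
  proof (rule that, rule partials_imp_C2_estimates[OF S(1,2) \<open>0 \<le> B\<close>])
    fix x i k l m assume "x \<in> S"
    hence x: "x \<in> M" using S(3) by auto
    show "has_partial k (\<lambda>y. V y $ i) (partials [k] (\<lambda>y. V y $ i) x) x"
      using has_partials_imp_has_partial *[of "[k]" x i] x by fastforce
    show "has_partial l (partials [k] (\<lambda>y. V y $ i)) (partials [l, k] (\<lambda>y. V y $ i) x) x"
      using *[of "[l, k]" x i] x by (intro has_partials_imp_has_partial) simp
    show "has_partial m (partials [l, k] (\<lambda>y. V y $ i)) (partials [m, l, k] (\<lambda>y. V y $ i) x) x"
      using *[of "[m, l, k]" x i] x by (intro has_partials_imp_has_partial) simp
    show "\<bar>partials [k] (\<lambda>y. V y $ i) x\<bar> \<le> B" "\<bar>partials [l, k] (\<lambda>y. V y $ i) x\<bar> \<le> B"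
      "\<bar>partials [m, l, k] (\<lambda>y. V y $ i) x\<bar> \<le> B"
      using *[of "[k]" x i] *[of "[l, k]" x i] *[of "[m, l, k]" x i] x by simp_all
  qed
qed

text \<open>The derivatives and their bound are parameters because the bound has to be the same for
  all \<omega>. As in \<open>partials [i, j]\<close>, the direction \<open>i\<close> of
  \<open>g2 i j\<close> is differentiated last.\<close>

definition C2_on :: "(real^'n) set \<Rightarrow> (real^'n \<Rightarrow> real) \<Rightarrow> ('n \<Rightarrow> real^'n \<Rightarrow> real) \<Rightarrow>
    ('n \<Rightarrow> 'n \<Rightarrow> real^'n \<Rightarrow> real) \<Rightarrow> real \<Rightarrow> bool"
  where "C2_on U g g1 g2 D \<longleftrightarrow>
    continuous_on U g \<and> (\<forall>i. continuous_on U (g1 i)) \<and> (\<forall>i j. continuous_on U (g2 i j)) \<and>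
    (\<forall>x\<in>U. \<bar>g x\<bar> \<le> D \<and> (\<forall>i. has_partial i g (g1 i x) x \<and> \<bar>g1 i x\<bar> \<le> D) \<and>
      (\<forall>i j. has_partial i (g1 j) (g2 i j x) x \<and> \<bar>g2 i j x\<bar> \<le> D))"

lemma C2_onD:
  assumes "C2_on U g g1 g2 D"
  shows "continuous_on U g" "continuous_on U (g1 i)" "continuous_on U (g2 i j)"
    and "x \<in> U \<Longrightarrow> \<bar>g x\<bar> \<le> D" "x \<in> U \<Longrightarrow> \<bar>g1 i x\<bar> \<le> D" "x \<in> U \<Longrightarrow> \<bar>g2 i j x\<bar> \<le> D"
    and "x \<in> U \<Longrightarrow> has_partial i g (g1 i x) x" "x \<in> U \<Longrightarrow> has_partial i (g1 j) (g2 i j x) x"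
  using assms unfolding C2_on_def by blast+

section \<open>Gluing with the zero function\<close>

lemma has_partial_cong:
  assumes "open U" "x \<in> U" "\<And>z. z \<in> U \<Longrightarrow> f z = g z"
  shows "has_partial i f d x \<longleftrightarrow> has_partial i g d x"
proof -
  have "\<forall>\<^sub>F s in nhds 0. x + s *\<^sub>R axis i 1 \<in> U"
    using open_line_preimage[OF assms(1), of x "axis i 1"] assms(2) by (auto simp: eventually_nhds)
  hence "\<forall>\<^sub>F s in nhds 0. f (x + s *\<^sub>R axis i 1) = g (x + s *\<^sub>R axis i 1)"
    by (rule eventually_mono) (rule assms(3))
  thus ?thesis unfolding has_partial_def by (intro DERIV_cong_ev) auto
qed

lemma partials_vanish:
  assumes "open N" "\<And>x. x \<in> N \<Longrightarrow> g x = 0" "x \<in> N"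
  shows "partials is g x = 0"
  using assms(3)
proof (induction "is" arbitrary: x)
  case (Cons i "is")
  have "has_partial i (partials is g) 0 x \<longleftrightarrow> has_partial i (\<lambda>_. 0) 0 x"
    using Cons by (intro has_partial_cong[OF assms(1)])
  thus ?case by (intro has_partial_imp_partials) (simp add: has_partial_def)
qed (use assms in auto)

text \<open>On both open sets the partials of the same \<open>g\<close> are computed, so there is no
  compatibility to check on the overlap; openness lets derivatives and continuity pass to the whole
  space.\<close>

lemma C_b_2_glue:
  fixes g :: "real^'n::finite \<Rightarrow> real"
  assumes U: "open U" "C2_on U g g1 g2 D" and N: "open N" "\<And>x. x \<in> N \<Longrightarrow> g x = 0"
    and UN: "U \<union> N = UNIV"
  shows "g \<in> C_b 2"
proof -
  note D = C2_onD[OF U(2)]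
  have eq1: "partials [i] g x = g1 i x" if "x \<in> U" for x i
    using D(7)[OF that] by (intro has_partial_imp_partials) simp
  have hp2: "has_partial i (partials [j] g) (g2 i j x) x" if "x \<in> U" for x i j
    using D(8)[OF that, of i j] has_partial_cong[OF U(1) that, where f = "partials [j] g" and g = "g1 j"] eq1 by blast
  have eq2: "partials [i, j] g x = g2 i j x" if "x \<in> U" for x i j
    using hp2[OF that] by (intro has_partial_imp_partials)
  have vanish: "partials is g x = 0" if "x \<in> N" for x "is"
    using N that by (rule partials_vanish)
  have hp0: "has_partial i (partials is g) 0 x" if "x \<in> N" for x i "is"
    using has_partial_cong[OF N(1) that, where f = "partials is g" and g = "\<lambda>_. 0"] vanish
    by (simp add: has_partial_def)
  have U_or_N: "x \<in> U \<or> x \<in> N" for x using UN by blast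
  show ?thesis
  proof (rule C_b_2I)
    fix x i j
    show "has_partial i g (partials [i] g x) x"
      using U_or_N[of x] D(7) eq1 hp0[of x i "[]"] vanish[of x "[i]"]
      by (auto simp del: partials.simps(2))
    show "has_partial i (partials [j] g) (partials [i, j] g x) x"
      using U_or_N[of x] hp2 eq2 hp0[of x i "[j]"] vanish[of x "[i, j]"]
      by (auto simp del: partials.simps(2))
  next
    fix "is" :: "'n list" assume l: "length is \<le> 2"
    have "continuous_on U (partials is g)"
      using length_le_2_cases[OF l] D(1-3) eq1 eq2 by (auto cong: continuous_on_cong simp del: partials.simps(2))
    moreover have "continuous_on N (partials is g)"
      using vanish by (simp cong: continuous_on_cong)
    ultimately show "continuous_on UNIV (partials is g)"
      unfolding UN[symmetric] using U(1) N(1) by (intro continuous_on_open_Un)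
    \<comment> \<open>The absolute value covers an empty \<open>U\<close>, for which
      \<open>D\<close> may be negative.\<close>
    have "\<bar>partials is g x\<bar> \<le> \<bar>D\<bar>" for x
    proof (cases "x \<in> U")
      case True
      hence "\<bar>partials is g x\<bar> \<le> D"
        using length_le_2_cases[OF l] D(4-6) eq1 eq2 by (auto simp del: partials.simps(2))
      thus ?thesis by linarith
    next
      case False
      thus ?thesis using U_or_N[of x] vanish[of x "is"] by simp
    qed
    thus "bounded (range (partials is g))" by (auto simp: bounded_iff)
  qed
qed

section \<open>Differentiation under the expectation\<close>

context prob_space
begin

lemma bounded_integrable:
  fixes F :: "'a \<Rightarrow> real"
  assumes "F \<in> borel_measurable M" "\<And>\<omega>. \<omega> \<in> space M \<Longrightarrow> \<bar>F \<omega>\<bar> \<le> B"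
  shows "integrable M F" "\<bar>\<integral>\<omega>. F \<omega> \<partial>M\<bar> \<le> B"
proof -
  show i: "integrable M F"
    using assms by (intro integrable_const_bound[of _ B]) auto
  have "\<bar>\<integral>\<omega>. F \<omega> \<partial>M\<bar> \<le> (\<integral>\<omega>. \<bar>F \<omega>\<bar> \<partial>M)" by (rule integral_abs_bound)
  also have "\<dots> \<le> B" using i assms(2) by (intro integral_le_const integrable_abs) auto
  finally show "\<bar>\<integral>\<omega>. F \<omega> \<partial>M\<bar> \<le> B" .
qed

lemma continuous_on_expectation:
  fixes F :: "'b::real_normed_vector \<Rightarrow> 'a \<Rightarrow> real"
  assumes F: "\<And>x. x \<in> U \<Longrightarrow> F x \<in> borel_measurable M"
    and B: "\<And>x \<omega>. x \<in> U \<Longrightarrow> \<omega> \<in> space M \<Longrightarrow> \<bar>F x \<omega>\<bar> \<le> B"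
    and c: "\<And>\<omega>. \<omega> \<in> space M \<Longrightarrow> continuous_on U (\<lambda>x. F x \<omega>)"
  shows "continuous_on U (\<lambda>x. \<integral>\<omega>. F x \<omega> \<partial>M)"
proof (rule continuous_on_sequentiallyI)
  fix u a assume u: "\<forall>n. u n \<in> U" "a \<in> U" "u \<longlonglongrightarrow> a"
  show "(\<lambda>n. \<integral>\<omega>. F (u n) \<omega> \<partial>M) \<longlonglongrightarrow> (\<integral>\<omega>. F a \<omega> \<partial>M)"
  proof (rule integral_dominated_convergence[where w = "\<lambda>_. B"])
    show "AE \<omega> in M. (\<lambda>n. F (u n) \<omega>) \<longlonglongrightarrow> F a \<omega>"
      using u by (intro AE_I2 continuous_on_tendsto_compose[OF c]) auto
  qed (use u F B in auto)
qed

text \<open>The mean value bound on the difference quotients provides the constant majorant for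
  dominated convergence. Measurability of \<open>F' x\<close> is a conclusion, obtained from a
  sequence of measurable quotients, so derivatives may be chosen separately for each
  \<omega>.\<close>

lemma has_partial_expectation:
  fixes F :: "real^'n::finite \<Rightarrow> 'a \<Rightarrow> real"
  assumes U: "open U" "x \<in> U"
    and F: "\<And>z. z \<in> U \<Longrightarrow> F z \<in> borel_measurable M"
    and B: "\<And>z \<omega>. z \<in> U \<Longrightarrow> \<omega> \<in> space M \<Longrightarrow> \<bar>F z \<omega>\<bar> \<le> B"
    and F': "\<And>z \<omega>. z \<in> U \<Longrightarrow> \<omega> \<in> space M \<Longrightarrow> has_partial i (\<lambda>z. F z \<omega>) (F' z \<omega>) z"
    and B': "\<And>z \<omega>. z \<in> U \<Longrightarrow> \<omega> \<in> space M \<Longrightarrow> \<bar>F' z \<omega>\<bar> \<le> B"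
  shows "F' x \<in> borel_measurable M"
    and "has_partial i (\<lambda>z. \<integral>\<omega>. F z \<omega> \<partial>M) (\<integral>\<omega>. F' x \<omega> \<partial>M) x"
proof -
  define e :: "real^'n" where "e = axis i 1"
  obtain \<delta> where \<delta>: "\<delta> > 0" "ball x \<delta> \<subseteq> U" using U open_contains_ball by blast
  have in_U: "x + s *\<^sub>R e \<in> U" if "s \<in> ball 0 \<delta>" for s
    using that \<delta>(2) by (auto simp: subset_iff e_def dist_norm)
  define Q where "Q = (\<lambda>s \<omega>. (F (x + s *\<^sub>R e) \<omega> - F x \<omega>) / s)"
  have deriv: "((\<lambda>s. F (x + s *\<^sub>R e) \<omega>) has_real_derivative F' (x + s *\<^sub>R e) \<omega>) (at s)"
    if "\<omega> \<in> space M" "s \<in> ball 0 \<delta>" for \<omega> s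
    using F'[OF in_U[OF that(2)] that(1)] unfolding e_def by (rule has_partial_along_line)
  have Q_meas: "Q s \<in> borel_measurable M" if "s \<in> ball 0 \<delta>" for s
    using F[OF in_U[OF that]] F[OF U(2)] unfolding Q_def by measurable
  have Q_le: "\<bar>Q s \<omega>\<bar> \<le> B" if "s \<in> ball 0 \<delta> - {0}" "\<omega> \<in> space M" for s \<omega>
  proof -
    have "norm (F (x + s *\<^sub>R e) \<omega> - F (x + 0 *\<^sub>R e) \<omega>) \<le> B * norm (s - 0)"
      using that \<delta>
      by (intro field_differentiable_bound[OF convex_ball[of 0 \<delta>], where f' = "\<lambda>s. F' (x + s *\<^sub>R e) \<omega>"]
          has_field_derivative_at_within[OF deriv]) (auto intro!: B' in_U)
    thus ?thesis using that by (simp add: Q_def divide_le_eq mult.commute)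
  qed
  have lim: "(\<lambda>n. Q (h n) \<omega>) \<longlonglongrightarrow> F' x \<omega>"
    if h: "\<And>n. h n \<in> ball 0 \<delta> - {0}" "h \<longlonglongrightarrow> 0" and \<omega>: "\<omega> \<in> space M" for h \<omega>
  proof -
    have "((\<lambda>s. Q s \<omega>) \<longlongrightarrow> F' x \<omega>) (at 0)"
      using deriv[OF \<omega>, of 0] \<delta>(1) by (simp add: has_field_derivative_iff Q_def)
    thus ?thesis using h unfolding tendsto_at_iff_sequentially o_def by blast
  qed
  define h where "h = (\<lambda>n. \<delta> / real (n + 2))"
  have h: "h n \<in> ball 0 \<delta> - {0}" for n
    using \<delta> by (auto simp: h_def field_simps add_pos_nonneg)
  have h0: "h \<longlonglongrightarrow> 0"
    unfolding h_def using LIMSEQ_ignore_initial_segment[OF lim_const_over_n[of \<delta>], of 2] by simp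
  show meas: "F' x \<in> borel_measurable M"
  proof (rule borel_measurable_LIMSEQ_real)
    show "(\<lambda>n. Q (h n) \<omega>) \<longlonglongrightarrow> F' x \<omega>" if "\<omega> \<in> space M" for \<omega>
      by (rule lim[OF h h0 that])
    show "Q (h n) \<in> borel_measurable M" for n
      using Q_meas h by blast
  qed
  have int: "integrable M (F z)" if "z \<in> U" for z
    by (rule bounded_integrable(1)[OF F B]) (use that in auto)
  have "((\<lambda>s. ((\<integral>\<omega>. F (x + s *\<^sub>R e) \<omega> \<partial>M) - (\<integral>\<omega>. F x \<omega> \<partial>M)) / s) \<longlongrightarrow> (\<integral>\<omega>. F' x \<omega> \<partial>M))
      (at 0 within ball 0 \<delta>)"
    unfolding tendsto_at_iff_sequentially o_def
  proof (intro allI impI)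
    fix h :: "nat \<Rightarrow> real" assume h: "\<forall>n. h n \<in> ball 0 \<delta> - {0}" "h \<longlonglongrightarrow> 0"
    have "((\<integral>\<omega>. F (x + h n *\<^sub>R e) \<omega> \<partial>M) - (\<integral>\<omega>. F x \<omega> \<partial>M)) / h n = (\<integral>\<omega>. Q (h n) \<omega> \<partial>M)" for n
      unfolding Q_def using h int[OF in_U, of "h n"] int[OF U(2)] by simp
    moreover have "(\<lambda>n. \<integral>\<omega>. Q (h n) \<omega> \<partial>M) \<longlonglongrightarrow> (\<integral>\<omega>. F' x \<omega> \<partial>M)"
    proof (rule integral_dominated_convergence[where w = "\<lambda>_. B"])
      show "AE \<omega> in M. (\<lambda>n. Q (h n) \<omega>) \<longlonglongrightarrow> F' x \<omega>"
        using h by (intro AE_I2 lim) auto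
      show "AE \<omega> in M. norm (Q (h n) \<omega>) \<le> B" for n
        using h Q_le by (intro AE_I2) auto
    qed (use meas h Q_meas in auto)
    ultimately show "(\<lambda>n. ((\<integral>\<omega>. F (x + h n *\<^sub>R e) \<omega> \<partial>M) - (\<integral>\<omega>. F x \<omega> \<partial>M)) / h n)
        \<longlonglongrightarrow> (\<integral>\<omega>. F' x \<omega> \<partial>M)" by simp
  qed
  thus "has_partial i (\<lambda>z. \<integral>\<omega>. F z \<omega> \<partial>M) (\<integral>\<omega>. F' x \<omega> \<partial>M) x"
    using at_within_open[of "0::real" "ball 0 \<delta>"] \<delta>(1)
    unfolding has_partial_def has_field_derivative_iff e_def by simp
qed

text \<open>\<open>has_partial_expectation\<close> is applied twice: the measurability of
  \<open>F1\<close> that it yields first is what its application to \<open>F1\<close>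
  requires.\<close>

lemma C2_on_expectation:
  fixes F :: "real^'n::finite \<Rightarrow> 'a \<Rightarrow> real"
  assumes U: "open U"
    and F: "\<And>x. x \<in> U \<Longrightarrow> F x \<in> borel_measurable M"
    and C2: "\<And>\<omega>. \<omega> \<in> space M \<Longrightarrow> C2_on U (\<lambda>x. F x \<omega>) (\<lambda>i x. F1 i x \<omega>) (\<lambda>i j x. F2 i j x \<omega>) D"
  shows "C2_on U (\<lambda>x. \<integral>\<omega>. F x \<omega> \<partial>M) (\<lambda>i x. \<integral>\<omega>. F1 i x \<omega> \<partial>M) (\<lambda>i j x. \<integral>\<omega>. F2 i j x \<omega> \<partial>M) D"
proof -
  note D = C2_onD[OF C2]
  have 1: "F1 i x \<in> borel_measurable M" "has_partial i (\<lambda>x. \<integral>\<omega>. F x \<omega> \<partial>M) (\<integral>\<omega>. F1 i x \<omega> \<partial>M) x"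
    if "x \<in> U" for i x
    by (rule has_partial_expectation[OF U that F D(4) D(7) D(5)]; simp)+
  have 2: "F2 i j x \<in> borel_measurable M"
    "has_partial i (\<lambda>x. \<integral>\<omega>. F1 j x \<omega> \<partial>M) (\<integral>\<omega>. F2 i j x \<omega> \<partial>M) x"
    if "x \<in> U" for i j x
    by (rule has_partial_expectation[OF U that 1(1) D(5) D(8) D(6)]; simp)+
  show ?thesis
    unfolding C2_on_def
  proof (intro conjI ballI allI)
    show "continuous_on U (\<lambda>x. \<integral>\<omega>. F x \<omega> \<partial>M)"
      by (rule continuous_on_expectation[OF F D(4) D(1)])
    show "continuous_on U (\<lambda>x. \<integral>\<omega>. F1 i x \<omega> \<partial>M)" for i
      by (rule continuous_on_expectation[OF 1(1) D(5) D(2)])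
    show "continuous_on U (\<lambda>x. \<integral>\<omega>. F2 i j x \<omega> \<partial>M)" for i j
      by (rule continuous_on_expectation[OF 2(1) D(6) D(3)])
    fix x assume x: "x \<in> U"
    show "\<bar>\<integral>\<omega>. F x \<omega> \<partial>M\<bar> \<le> D" by (rule bounded_integrable(2)[OF F[OF x] D(4)[OF _ x]])
    show "\<bar>\<integral>\<omega>. F1 i x \<omega> \<partial>M\<bar> \<le> D" for i by (rule bounded_integrable(2)[OF 1(1)[OF x] D(5)[OF _ x]])
    show "\<bar>\<integral>\<omega>. F2 i j x \<omega> \<partial>M\<bar> \<le> D" for i j
      by (rule bounded_integrable(2)[OF 2(1)[OF x] D(6)[OF _ x]])
  qed (use 1(2) 2(2) in auto)
qed

end

section \<open>Composition with the flow\<close>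

lemma quadratic_error_imp_has_vector_derivative:
  fixes u :: "real \<Rightarrow> 'a::real_normed_vector"
  assumes I: "open I" "0 \<in> I" and u: "\<And>r. r \<in> I \<Longrightarrow> norm (u r - u 0 - r *\<^sub>R d) \<le> C * r\<^sup>2"
  shows "(u has_vector_derivative d) (at 0)"
  unfolding has_vector_derivative_def has_derivative_within_alt
proof (intro conjI allI impI)
  show "bounded_linear (\<lambda>r. r *\<^sub>R d)" by (rule bounded_linear_scaleR_left)
  fix e :: real assume e: "e > 0"
  obtain \<rho> where \<rho>: "\<rho> > 0" "ball 0 \<rho> \<subseteq> I" using I open_contains_ball by blast
  have C: "0 < \<bar>C\<bar> + 1" by simp
  show "\<exists>\<delta>>0. \<forall>r\<in>UNIV. norm (r - 0) < \<delta> \<longrightarrow> norm (u r - u 0 - (r - 0) *\<^sub>R d) \<le> e * norm (r - 0)"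
  proof (intro exI[of _ "min \<rho> (e / (\<bar>C\<bar> + 1))"] conjI ballI impI)
    show "0 < min \<rho> (e / (\<bar>C\<bar> + 1))" using \<rho>(1) e C by simp
    fix r :: real assume r: "norm (r - 0) < min \<rho> (e / (\<bar>C\<bar> + 1))"
    have "norm (u r - u 0 - r *\<^sub>R d) \<le> C * r\<^sup>2" using r \<rho>(2) by (intro u) auto
    also have "\<dots> \<le> (\<bar>C\<bar> + 1) * \<bar>r\<bar> * \<bar>r\<bar>"
      by (simp add: power2_eq_square mult.assoc abs_mult_self_eq mult_right_mono)
    also have "\<dots> \<le> e * \<bar>r\<bar>"
      using r C by (intro mult_right_mono) (auto simp: pos_less_divide_eq mult.commute)
    finally show "norm (u r - u 0 - (r - 0) *\<^sub>R d) \<le> e * norm (r - 0)" by simp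
  qed
qed

text \<open>Near each point \<open>D\<close> is a uniform limit of continuous difference quotients.
  Half the radius is reserved for the shift by \<open>r *\<^sub>R e\<close>. This supplies the
  continuity of the second derivatives of the flow, for which \<open>flow_C2\<close> states no
  Lipschitz bound.\<close>

lemma continuous_on_of_quadratic_error:
  fixes G :: "'b::real_normed_vector \<Rightarrow> 'a::real_normed_vector"
  assumes U: "open U" and G: "continuous_on U G" and e: "norm e = 1"
    and D: "\<And>x r. x \<in> U \<Longrightarrow> x + r *\<^sub>R e \<in> U \<Longrightarrow> norm (G (x + r *\<^sub>R e) - G x - r *\<^sub>R D x) \<le> C * r\<^sup>2"
  shows "continuous_on U D"
  unfolding continuous_on_eq_continuous_at[OF U]
proof
  fix x\<^sub>0 assume "x\<^sub>0 \<in> U"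
  then obtain \<rho> where \<rho>: "\<rho> > 0" "ball x\<^sub>0 \<rho> \<subseteq> U" using U open_contains_ball by blast
  let ?B = "ball x\<^sub>0 (\<rho> / 2)"
  define q where "q = (\<lambda>r x. (G (x + r *\<^sub>R e) - G x) /\<^sub>R r)"
  have in_U: "x \<in> U" "x + r *\<^sub>R e \<in> U" if "x \<in> ?B" "0 < r" "r < \<rho> / 2" for x r
  proof -
    have "dist x\<^sub>0 (x + r *\<^sub>R e) \<le> dist x\<^sub>0 x + r"
      using dist_triangle[of x\<^sub>0 "x + r *\<^sub>R e" x] that e by (simp add: dist_norm)
    hence "dist x\<^sub>0 (x + r *\<^sub>R e) < \<rho>" "dist x\<^sub>0 x < \<rho>" using that \<rho>(1) by auto
    thus "x \<in> U" "x + r *\<^sub>R e \<in> U" using \<rho>(2) by auto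
  qed
  have small: "\<forall>\<^sub>F r in at_right 0. 0 < r \<and> r < \<rho> / 2"
    using \<rho>(1) eventually_at_right[of 0 "\<rho> / 2"] by (auto intro: exI[of _ "\<rho> / 2"])
  have "continuous_on ?B D"
  proof (rule uniform_limit_theorem)
    show "\<forall>\<^sub>F r in at_right 0. continuous_on ?B (q r)"
      using small
    proof eventually_elim
      case (elim r)
      have "continuous_on ?B (\<lambda>x. G (x + r *\<^sub>R e))"
        using elim in_U by (intro continuous_on_compose2[OF G] continuous_intros) auto
      moreover have "continuous_on ?B G"
        using elim in_U by (intro continuous_on_subset[OF G]) auto
      ultimately show ?case unfolding q_def by (intro continuous_intros)
    qed
    show "uniform_limit ?B q D (at_right 0)"
    proof (rule uniform_limitI)
      fix \<epsilon> :: real assume \<epsilon>: "\<epsilon> > 0"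
      have "((\<lambda>r. C * r) \<longlongrightarrow> C * 0) (at_right 0)" by (intro tendsto_intros)
      hence "\<forall>\<^sub>F r in at_right 0. C * r < \<epsilon>" using \<epsilon> by (intro order_tendstoD(2)) auto
      with small show "\<forall>\<^sub>F r in at_right 0. \<forall>x\<in>?B. dist (q r x) (D x) < \<epsilon>"
      proof eventually_elim
        case (elim r)
        show ?case
        proof
          fix x assume x: "x \<in> ?B"
          have "G (x + r *\<^sub>R e) - G x - r *\<^sub>R D x = r *\<^sub>R (q r x - D x)"
            using elim by (simp add: q_def scaleR_diff_right)
          hence "dist (q r x) (D x) = norm (G (x + r *\<^sub>R e) - G x - r *\<^sub>R D x) / r"
            using elim by (simp add: dist_norm)
          also have "\<dots> \<le> C * r\<^sup>2 / r"
            using elim in_U[OF x] by (intro divide_right_mono D) auto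
          also have "\<dots> = C * r" using elim by (simp add: power2_eq_square)
          finally show "dist (q r x) (D x) < \<epsilon>" using elim by linarith
        qed
      qed
    qed
  qed simp
  thus "isCont D x\<^sub>0" using \<rho>(1) by (auto simp: continuous_on_eq_continuous_at)
qed

lemma lipschitz_imp_continuous_on:
  fixes g :: "'a::real_normed_vector \<Rightarrow> 'b::real_normed_vector"
  assumes "\<And>x z. x \<in> U \<Longrightarrow> z \<in> U \<Longrightarrow> norm (g z - g x) \<le> C * norm (z - x)"
  shows "continuous_on U g"
proof (rule lipschitz_on_continuous_on)
  show "\<bar>C\<bar>-lipschitz_on U g"
  proof (rule lipschitz_onI)
    fix x y assume "x \<in> U" "y \<in> U"
    hence "norm (g x - g y) \<le> C * norm (x - y)" by (intro assms)
    also have "\<dots> \<le> \<bar>C\<bar> * norm (x - y)" by (intro mult_right_mono) auto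
    finally show "dist (g x) (g y) \<le> \<bar>C\<bar> * dist x y" by (simp add: dist_norm)
  qed simp
qed

text \<open>The hypotheses on \<open>\<phi>\<close>, \<open>J\<close> and \<open>H\<close> are the
  conclusions of \<open>flow_C2\<close> for unit coordinate vectors. The final constant adds the
  bounds of the composition and of its first and second partials, so that it majorises each; it is
  built from \<open>B\<close>, \<open>C\<close> and the dimension alone.\<close>

lemma C2_on_compose_flow:
  fixes \<phi> :: "real^'n::finite \<Rightarrow> real^'n" and C B :: real
  assumes U: "open U" and C: "0 \<le> C" and f: "C2_on UNIV f f1 f2 B"
    and \<phi>: "\<And>x z. x \<in> U \<Longrightarrow> z \<in> U \<Longrightarrow> norm (\<phi> z - \<phi> x) \<le> C * norm (z - x)"
    and J_le: "\<And>i x. x \<in> U \<Longrightarrow> norm (J i x) \<le> C"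
    and J: "\<And>i x r. x \<in> U \<Longrightarrow> x + r *\<^sub>R axis i 1 \<in> U \<Longrightarrow>
      norm (\<phi> (x + r *\<^sub>R axis i 1) - \<phi> x - r *\<^sub>R J i x) \<le> C * r\<^sup>2"
    and J_lip: "\<And>i x z. x \<in> U \<Longrightarrow> z \<in> U \<Longrightarrow> norm (J i z - J i x) \<le> C * norm (z - x)"
    and H_le: "\<And>i j x. x \<in> U \<Longrightarrow> norm (H i j x) \<le> C"
    and H: "\<And>i j x r. x \<in> U \<Longrightarrow> x + r *\<^sub>R axis i 1 \<in> U \<Longrightarrow>
      norm (J j (x + r *\<^sub>R axis i 1) - J j x - r *\<^sub>R H i j x) \<le> C * r\<^sup>2"
  defines "N \<equiv> real CARD('n)"
  shows "C2_on U (\<lambda>x. f (\<phi> x)) (\<lambda>j x. \<Sum>k\<in>UNIV. f1 k (\<phi> x) * J j x $ k)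
    (\<lambda>i j x. \<Sum>k\<in>UNIV. (\<Sum>l\<in>UNIV. f2 l k (\<phi> x) * J i x $ l) * J j x $ k + f1 k (\<phi> x) * H i j x $ k)
    (B + N * B * C + N * (N * B * C) * C + N * B * C)"
proof -
  note fD = C2_onD[OF f]
  have B: "0 \<le> B" using fD(4)[OF UNIV_I] abs_ge_zero order.trans by blast
  have N: "0 \<le> N" by (simp add: N_def)
  have f_deriv: "(f has_derivative (\<lambda>h. \<Sum>k\<in>UNIV. f1 k y * h $ k)) (at y)" for y
    by (rule partials_continuous_imp_has_derivative[OF open_UNIV UNIV_I fD(7) fD(2)])
  have f1_deriv: "(f1 k has_derivative (\<lambda>h. \<Sum>l\<in>UNIV. f2 l k y * h $ l)) (at y)" for k y
    by (rule partials_continuous_imp_has_derivative[OF open_UNIV UNIV_I fD(8) fD(3)])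
  \<comment> \<open>Differentiability of \<open>\<phi>\<close> along coordinate lines is enough
    here, because the outer function is totally differentiable.\<close>
  have chain: "has_partial i (\<lambda>x. g (\<phi> x)) (\<Sum>k\<in>UNIV. a k * J i x $ k) x"
    if g: "(g has_derivative (\<lambda>h. \<Sum>k\<in>UNIV. a k * h $ k)) (at (\<phi> x))" and x: "x \<in> U" for g a i x
  proof -
    have "((\<lambda>r. \<phi> (x + r *\<^sub>R axis i 1)) has_vector_derivative J i x) (at 0)"
      using x J by (intro quadratic_error_imp_has_vector_derivative[OF
          open_line_preimage[OF U, of x "axis i 1"]]) auto
    hence "((\<lambda>r. \<phi> (x + r *\<^sub>R axis i 1)) has_derivative (\<lambda>r. r *\<^sub>R J i x)) (at 0)"
      by (simp add: has_vector_derivative_def)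
    from has_derivative_compose[OF this, of g "\<lambda>h. \<Sum>k\<in>UNIV. a k * h $ k"] g
    have "((\<lambda>r. g (\<phi> (x + r *\<^sub>R axis i 1))) has_derivative
        (\<lambda>r. \<Sum>k\<in>UNIV. a k * (r *\<^sub>R J i x) $ k)) (at 0)" by simp
    moreover have "(\<lambda>r. \<Sum>k\<in>UNIV. a k * (r *\<^sub>R J i x) $ k) = (*) (\<Sum>k\<in>UNIV. a k * J i x $ k)"
      by (rule ext) (simp add: sum_distrib_left mult_ac)
    ultimately show ?thesis by (simp add: has_partial_def has_field_derivative_def)
  qed
  have J_partial: "has_partial i (\<lambda>x. J j x $ k) (H i j x $ k) x" if x: "x \<in> U" for i j k x
  proof -
    have "((\<lambda>r. J j (x + r *\<^sub>R axis i 1)) has_vector_derivative H i j x) (at 0)"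
      using x H by (intro quadratic_error_imp_has_vector_derivative[OF
          open_line_preimage[OF U, of x "axis i 1"]]) auto
    from bounded_linear.has_vector_derivative[OF bounded_linear_vec_nth this]
    show ?thesis by (simp add: has_partial_def has_real_derivative_iff_has_vector_derivative)
  qed
  have \<phi>_cont: "continuous_on U \<phi>" by (rule lipschitz_imp_continuous_on[OF \<phi>])
  have J_cont: "continuous_on U (J i)" for i by (rule lipschitz_imp_continuous_on[OF J_lip])
  have H_cont: "continuous_on U (H i j)" for i j
    by (rule continuous_on_of_quadratic_error[where e = "axis i 1", OF U J_cont _ H]) simp_all
  have f_cont: "continuous_on U (\<lambda>x. f (\<phi> x))" "continuous_on U (\<lambda>x. f1 k (\<phi> x))"
    "continuous_on U (\<lambda>x. f2 l k (\<phi> x))" for k l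
    by (intro continuous_on_compose2[OF fD(1) \<phi>_cont] continuous_on_compose2[OF fD(2) \<phi>_cont]
        continuous_on_compose2[OF fD(3) \<phi>_cont] subset_UNIV)+
  have le: "\<bar>\<Sum>k\<in>UNIV. a k * v $ k\<bar> \<le> N * c * C"
    if "\<And>k. \<bar>a k\<bar> \<le> c" "0 \<le> c" "norm v \<le> C" for a c and v :: "real^'n"
  proof -
    have "\<bar>\<Sum>k\<in>UNIV. a k * v $ k\<bar> \<le> N * c * norm v"
      unfolding N_def by (rule abs_sum_mult_le[OF that(1,2)])
    also have "\<dots> \<le> N * c * C" using that N by (intro mult_left_mono) auto
    finally show ?thesis .
  qed
  have nonneg: "0 \<le> N * B * C" "0 \<le> N * (N * B * C) * C" using N B C by auto
  show ?thesis
    unfolding C2_on_def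
  proof (intro conjI ballI allI)
    fix i j
    show "continuous_on U (\<lambda>x. f (\<phi> x))" by (rule f_cont)
    show "continuous_on U (\<lambda>x. \<Sum>k\<in>UNIV. f1 k (\<phi> x) * J j x $ k)"
      by (intro continuous_intros f_cont J_cont)
    show "continuous_on U (\<lambda>x. \<Sum>k\<in>UNIV. (\<Sum>l\<in>UNIV. f2 l k (\<phi> x) * J i x $ l) * J j x $ k
        + f1 k (\<phi> x) * H i j x $ k)"
      by (intro continuous_intros f_cont J_cont H_cont)
    fix x assume x: "x \<in> U"
    show "has_partial i (\<lambda>x. f (\<phi> x)) (\<Sum>k\<in>UNIV. f1 k (\<phi> x) * J i x $ k) x"
      by (rule chain[OF f_deriv x])
    have "((\<lambda>s. f1 k (\<phi> (x + s *\<^sub>R axis i 1)) * J j (x + s *\<^sub>R axis i 1) $ k) has_real_derivative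
        (\<Sum>l\<in>UNIV. f2 l k (\<phi> x) * J i x $ l) * J j x $ k + f1 k (\<phi> x) * H i j x $ k) (at 0)" for k
      using DERIV_mult[OF chain[OF f1_deriv x, unfolded has_partial_def]
          J_partial[OF x, unfolded has_partial_def]] by (simp add: mult.commute)
    thus "has_partial i (\<lambda>x. \<Sum>k\<in>UNIV. f1 k (\<phi> x) * J j x $ k)
        (\<Sum>k\<in>UNIV. (\<Sum>l\<in>UNIV. f2 l k (\<phi> x) * J i x $ l) * J j x $ k + f1 k (\<phi> x) * H i j x $ k) x"
      unfolding has_partial_def by (intro DERIV_sum)
    show "\<bar>f (\<phi> x)\<bar> \<le> B + N * B * C + N * (N * B * C) * C + N * B * C"
      using fD(4)[OF UNIV_I, of "\<phi> x"] nonneg by linarith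
    have "\<bar>\<Sum>k\<in>UNIV. f1 k (\<phi> x) * J i x $ k\<bar> \<le> N * B * C"
      by (rule le[OF fD(5)[OF UNIV_I] B J_le[OF x]])
    thus "\<bar>\<Sum>k\<in>UNIV. f1 k (\<phi> x) * J i x $ k\<bar> \<le> B + N * B * C + N * (N * B * C) * C + N * B * C"
      using nonneg B by linarith
    have "\<bar>\<Sum>l\<in>UNIV. f2 l k (\<phi> x) * J i x $ l\<bar> \<le> N * B * C" for k
      by (rule le[OF fD(6)[OF UNIV_I] B J_le[OF x]])
    hence "\<bar>\<Sum>k\<in>UNIV. (\<Sum>l\<in>UNIV. f2 l k (\<phi> x) * J i x $ l) * J j x $ k\<bar> \<le> N * (N * B * C) * C"
      by (rule le[OF _ nonneg(1) J_le[OF x]])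
    moreover have "\<bar>\<Sum>k\<in>UNIV. f1 k (\<phi> x) * H i j x $ k\<bar> \<le> N * B * C"
      by (rule le[OF fD(5)[OF UNIV_I] B H_le[OF x]])
    ultimately show "\<bar>\<Sum>k\<in>UNIV. (\<Sum>l\<in>UNIV. f2 l k (\<phi> x) * J i x $ l) * J j x $ k
        + f1 k (\<phi> x) * H i j x $ k\<bar> \<le> B + N * B * C + N * (N * B * C) * C + N * B * C"
      using B nonneg unfolding sum.distrib by linarith
  qed
qed

lemma C_b_2_imp_C2_on:
  fixes f :: "real^'n::finite \<Rightarrow> real"
  assumes "f \<in> C_b 2"
  obtains f1 f2 B where "C2_on UNIV f f1 f2 B"
proof -
  have "\<exists>B. \<forall>x. \<bar>partials is f x\<bar> \<le> B" if "length is \<le> 2" for "is" :: "'n list"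
    using C_b_partials(3)[OF assms that] by (auto simp: bounded_iff)
  then obtain b where b: "\<And>is x. length is \<le> 2 \<Longrightarrow> \<bar>partials is f x\<bar> \<le> b is" by metis
  define B where "B = Max (b ` {is. set is \<subseteq> UNIV \<and> length is \<le> 2})"
  have B: "\<bar>partials is f x\<bar> \<le> B" if "length is \<le> 2" for "is" x
    unfolding B_def using b[OF that] that
    by (intro order.trans[OF b[OF that]] Max_ge finite_imageI finite_lists_length_le) auto
  have hp: "has_partial i (partials is f) (partials (i # is) f x) x" if "length is \<le> 1" for i "is" x
    using that by (intro has_partials_imp_has_partial C_b_partials(1)[OF assms]) auto
  show ?thesis
  proof (rule that)
    show "C2_on UNIV f (\<lambda>i. partials [i] f) (\<lambda>i j. partials [i, j] f) B"
      unfolding C2_on_def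
      using C_b_partials(2)[OF assms, of "[]"] C_b_partials(2)[OF assms, of "[_]"]
        C_b_partials(2)[OF assms, of "[_, _]"] B[of "[]"] B[of "[_]"] B[of "[_, _]"]
        hp[of "[]"] hp[of "[_]"]
      by (auto simp del: partials.simps(2))
  qed
qed

section \<open>Regularity of the transition operator\<close>

lemma open_cube: "open (cube x r)"
proof -
  have "continuous_on UNIV (\<lambda>y. infnorm (y - x))"
    unfolding continuous_on_def by (intro ballI tendsto_infnorm tendsto_intros)
  thus ?thesis unfolding cube_def by (intro open_Collect_less continuous_on_const)
qed

theorem theorem3p1:
  fixes P :: "'w measure"
    and X :: "real \<Rightarrow> 'w \<Rightarrow> real^'n::finite"
    and V :: "real^'n \<Rightarrow> real^'n"
    and Y :: "real^'n \<Rightarrow> real \<Rightarrow> 'w \<Rightarrow> real^'n"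
    and f :: "real^'n \<Rightarrow> real"
    and t\<^sub>0 :: real
    and K M :: "(real^'n) set"
  assumes "prob_space P"
    and "\<And>i. levy_process P (\<lambda>t \<omega>. X t \<omega> $ i)"
    and "\<And>\<omega>. \<omega> \<in> space P \<Longrightarrow> X 0 \<omega> = 0"
    and "local_lipschitz (UNIV :: real set) UNIV (\<lambda>_. V)"
    and "\<And>x. solution_process P V X x (Y x)"
    and "f \<in> C_b 2"
    and "0 < t\<^sub>0"
    and "\<And>x \<omega>. \<omega> \<in> space P \<Longrightarrow> explosion_time V (\<lambda>t. X t \<omega>) x = \<infinity>"
    and "\<And>t. 0 \<le> t \<Longrightarrow> t \<le> t\<^sub>0 \<Longrightarrow> closure {x. transition_op P V X Y t f x \<noteq> 0} \<subseteq> K"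
    and "convex M"
    and "\<And>x t \<omega>. x \<in> (\<Union>z\<in>K. cube z 3) \<Longrightarrow> 0 \<le> t \<Longrightarrow> t \<le> t\<^sub>0 \<Longrightarrow> \<omega> \<in> space P \<Longrightarrow> Y x t \<omega> \<in> M"
    and "sup_norm M V < \<infinity>"
    and "\<And>j. j \<in> {1, 2, 3} \<Longrightarrow> derivs_exist_on j M V \<and> deriv_norm j M V < \<infinity>"
  shows "\<forall>t. 0 \<le> t \<and> t \<le> t\<^sub>0 \<longrightarrow> transition_op P V X Y t f \<in> C_b 2"
proof (intro allI impI, elim conjE)
  fix t :: real assume t: "0 \<le> t" "t \<le> t\<^sub>0"
  note sol = assms(5) and expl = assms(8)
  interpret prob_space P by fact
  define U where "U = (\<Union>z\<in>K. cube z 3)"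
  have U: "open U" unfolding U_def by (intro open_UN ballI open_cube)
  have KU: "K \<subseteq> U" by (auto simp: U_def cube_def infnorm_0)
  define T where "T = transition_op P V X Y t f"
  define F where "F = (\<lambda>x \<omega>. f (Y x t \<omega>))"
  \<comment> \<open>Without explosion the set of integration is the whole space.\<close>
  have T_eq: "T = (\<lambda>x. \<integral>\<omega>. F x \<omega> \<partial>P)"
    unfolding T_def F_def transition_op_def set_lebesgue_integral_def
    using expl by (intro ext Bochner_Integration.integral_cong) auto
  have F_meas: "F x \<in> borel_measurable P" for x
  proof -
    have "f \<in> borel_measurable borel"
      using C_b_partials(2)[OF assms(6), of "[]"] by (intro borel_measurable_continuous_onI) simp
    moreover have "Y x t \<in> borel_measurable P"
      using sol[of x] t by (auto simp: solution_process_def)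
    ultimately show ?thesis unfolding F_def by measurable
  qed
  have "\<exists>g1 g2 D. C2_on U T g1 g2 D"
  \<comment> \<open>For empty \<open>K\<close> the interior of \<open>M\<close> may be empty, but
    then the claim on \<open>U\<close> is vacuous.\<close>
  proof (cases "U = {}")
    case True
    thus ?thesis by (auto simp: C2_on_def)
  next
    case False
    have Y_sol: "solves_on V (\<lambda>s. X s \<omega>) x (\<lambda>s. Y x s \<omega>) t\<^sub>0" if "\<omega> \<in> space P" for x \<omega>
    proof -
      have "solves_until V (\<lambda>s. X s \<omega>) x (\<lambda>s. Y x s \<omega>) \<infinity>"
        using sol[of x] that expl[OF that, of x] by (auto simp: solution_process_def)
      thus ?thesis by (simp add: solves_until_def solves_on_def)
    qed
    have Y_M: "Y x s \<omega> \<in> M" if "x \<in> U" "s \<in> {0..t\<^sub>0}" "\<omega> \<in> space P" for x s \<omega>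
      using assms(11)[of x s \<omega>] that by (auto simp: U_def)
    \<comment> \<open>At time 0 every solution is at its starting point. As \<open>U\<close> is open
      and nonempty, this gives \<open>M\<close> interior points.\<close>
    have "U \<subseteq> M"
    proof
      fix x assume x: "x \<in> U"
      obtain \<omega> where \<omega>: "\<omega> \<in> space P" using not_empty by blast
      have "Y x 0 \<omega> = x"
        using Y_sol[OF \<omega>, of x] assms(3)[OF \<omega>] assms(7) by (auto simp: solves_on_def)
      thus "x \<in> M" using Y_M[OF x _ \<omega>, of 0] assms(7) by auto
    qed
    with U False have int_M: "interior M \<noteq> {}" using interior_maximal by blast
    obtain L V1 V2 where est: "C2_estimates (interior M) L V V1 V2"
      by (rule derivs_imp_C2_estimates[OF open_interior convex_interior[OF assms(10)] interior_subset assms(13)])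
    have L: "0 \<le> L" using C2_estimatesD(1)[OF est] int_M by blast
    \<comment> \<open>The solutions are so far known to lie in \<open>M\<close> only. A convex set
      with interior points lies in the closure of its interior, and \<open>V\<close> is continuous,
      so the Lipschitz constant extends to all of \<open>M\<close>.\<close>
    have "L-lipschitz_on (interior M) V"
      using L C2_estimatesD(6)[OF est] by (intro lipschitz_onI) (auto simp: dist_norm)
    moreover have "continuous_on (closure (interior M)) V"
      using local_lipschitz_continuous_on[OF assms(4), of 0] by (auto intro: continuous_on_subset)
    ultimately have "L-lipschitz_on (closure M) V"
      unfolding convex_closure_interior[OF assms(10) int_M, symmetric] by (rule lipschitz_on_closure)
    hence V_lip: "norm (V a - V b) \<le> L * norm (a - b)" if "a \<in> M" "b \<in> M" for a b
      using that closure_subset[of M] by (auto simp: lipschitz_on_def dist_norm subset_iff)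
    \<comment> \<open>The flow at a fixed time is an injective continuous map of the open set \<open>U\<close> into \<open>M\<close>, hence
      open; so the solutions never touch the boundary of \<open>M\<close>.\<close>
    have Y_int: "Y x s \<omega> \<in> interior M" if x: "x \<in> U" and s: "s \<in> {0..t\<^sub>0}" and \<omega>: "\<omega> \<in> space P" for x s \<omega>
    proof -
      have lip: "norm (V (Y x r \<omega>) - V (Y z r \<omega>)) \<le> L * norm (Y x r \<omega> - Y z r \<omega>)"
        if "x \<in> U" "z \<in> U" "r \<in> {0..t\<^sub>0}" for x z r
        using that \<omega> by (intro V_lip Y_M)
      have "norm (Y z s \<omega> - Y x s \<omega>) \<le> exp (L * s) * norm (z - x)" if "x \<in> U" "z \<in> U" for x z
        using solves_on_diff_le[OF Y_sol[OF \<omega>] Y_sol[OF \<omega>] L s lip[OF that(2,1)]]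
        by (simp add: mult.commute)
      hence "continuous_on U (\<lambda>x. Y x s \<omega>)"
        by (rule lipschitz_imp_continuous_on)
      moreover have "inj_on (\<lambda>x. Y x s \<omega>) U"
        by (intro inj_onI) (rule solves_on_inj[OF Y_sol[OF \<omega>] Y_sol[OF \<omega>] L s lip])
      ultimately have "open ((\<lambda>x. Y x s \<omega>) ` U)"
        using U by (intro invariance_of_domain)
      moreover have "(\<lambda>x. Y x s \<omega>) ` U \<subseteq> M" using Y_M s \<omega> by auto
      ultimately show ?thesis using x interior_maximal by blast
    qed
    obtain f1 f2 B where f: "C2_on UNIV f f1 f2 B" using C_b_2_imp_C2_on[OF assms(6)] .
    define C where "C = flow_bound L t\<^sub>0 + flow_bound (2 * L + L * exp (L * t\<^sub>0)) t\<^sub>0"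
    have t\<^sub>0: "0 \<le> t\<^sub>0" and t': "t \<in> {0..t\<^sub>0}" using t by auto
    have C0: "0 \<le> C" unfolding C_def using L t\<^sub>0 by (intro add_nonneg_nonneg flow_bound_ge(3)) auto
    \<comment> \<open>The order of the quantifiers is the point: \<open>D\<close> is chosen before
      \<omega>, the derivatives after it.\<close>
    have "\<exists>D. \<forall>\<omega>\<in>space P. \<exists>F1 F2. C2_on U (\<lambda>x. F x \<omega>) F1 F2 D"
    proof (rule exI, rule ballI)
      fix \<omega> assume \<omega>: "\<omega> \<in> space P"
      show "\<exists>F1 F2. C2_on U (\<lambda>x. F x \<omega>) F1 F2 (B + real CARD('n) * B * C
          + real CARD('n) * (real CARD('n) * B * C) * C + real CARD('n) * B * C)"
      proof (rule flow_C2[OF est t\<^sub>0 L U, where \<xi> = "\<lambda>s. X s \<omega>" and y = "\<lambda>x s. Y x s \<omega>", folded C_def])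
        fix J H
        assume *: "\<And>x z t. x \<in> U \<Longrightarrow> z \<in> U \<Longrightarrow> t \<in> {0..t\<^sub>0} \<Longrightarrow> norm (Y z t \<omega> - Y x t \<omega>) \<le> C * norm (z - x)"
          "\<And>e x t. x \<in> U \<Longrightarrow> t \<in> {0..t\<^sub>0} \<Longrightarrow> norm e = 1 \<Longrightarrow> norm (J e x t) \<le> C"
          "\<And>e x t r. x \<in> U \<Longrightarrow> x + r *\<^sub>R e \<in> U \<Longrightarrow> t \<in> {0..t\<^sub>0} \<Longrightarrow> norm e = 1 \<Longrightarrow>
            norm (Y (x + r *\<^sub>R e) t \<omega> - Y x t \<omega> - r *\<^sub>R J e x t) \<le> C * r\<^sup>2"
          "\<And>e x z t. x \<in> U \<Longrightarrow> z \<in> U \<Longrightarrow> t \<in> {0..t\<^sub>0} \<Longrightarrow> norm e = 1 \<Longrightarrow>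
            norm (J e z t - J e x t) \<le> C * norm (z - x)"
          "\<And>e e' x t. x \<in> U \<Longrightarrow> t \<in> {0..t\<^sub>0} \<Longrightarrow> norm e = 1 \<Longrightarrow> norm e' = 1 \<Longrightarrow> norm (H e' e x t) \<le> C"
          "\<And>e e' x t r. x \<in> U \<Longrightarrow> x + r *\<^sub>R e' \<in> U \<Longrightarrow> t \<in> {0..t\<^sub>0} \<Longrightarrow> norm e = 1 \<Longrightarrow> norm e' = 1 \<Longrightarrow>
            norm (J e (x + r *\<^sub>R e') t - J e x t - r *\<^sub>R H e' e x t) \<le> C * r\<^sup>2"
        show ?thesis
          unfolding F_def
          by (intro exI, rule C2_on_compose_flow[OF U C0 f, where J = "\<lambda>i x. J (axis i 1) x t"
                and H = "\<lambda>i j x. H (axis i 1) (axis j 1) x t"])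
            (rule *; (assumption | rule t' | simp))+
      qed (use Y_sol Y_int \<omega> in auto)
    qed
    then obtain D where "\<forall>\<omega>\<in>space P. \<exists>F1 F2. C2_on U (\<lambda>x. F x \<omega>) F1 F2 D" ..
    \<comment> \<open>The derivatives are picked for each \<omega> by choice;
      \<open>C2_on_expectation\<close> asks for measurability of \<open>F\<close> only.\<close>
    then obtain F1 F2 where F: "\<And>\<omega>. \<omega> \<in> space P \<Longrightarrow> C2_on U (\<lambda>x. F x \<omega>) (F1 \<omega>) (F2 \<omega>) D"
      by metis
    from C2_on_expectation[where ?F1.0 = "\<lambda>i x \<omega>. F1 \<omega> i x" and ?F2.0 = "\<lambda>i j x \<omega>. F2 \<omega> i j x",
        OF U F_meas F]
    show ?thesis unfolding T_eq by blast
  qed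
  then obtain g1 g2 D where T: "C2_on U T g1 g2 D" by blast
  \<comment> \<open>The support is closed and contained in \<open>U\<close>, so \<open>U\<close> and
    the complement of the support are two open sets that cover the space.\<close>
  have supp: "closure {x. T x \<noteq> 0} \<subseteq> U"
    using assms(9)[OF t] KU unfolding T_def by blast
  show "transition_op P V X Y t f \<in> C_b 2"
    unfolding T_def[symmetric]
  proof (rule C_b_2_glue[OF U T])
    show "open (- closure {x. T x \<noteq> 0})" by (rule open_Compl[OF closed_closure])
    show "T x = 0" if "x \<in> - closure {x. T x \<noteq> 0}" for x
      using that closure_subset[of "{x. T x \<noteq> 0}"] by auto
  qed (use supp in auto)
qed

end
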